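(* Let $2\le n_1<n_2<n_3$ be integers with $\frac{\log n_1}{\log n_2}<\frac{\log n_2}{\log n_3}$, and let $F\subset[0,1]^3$ be the Bedford--McMullen sponge generated by a set $\mathcal{D}\subset\mathcal{I}_1\times\mathcal{I}_2\times\mathcal{I}_3$ with at least two elements; assume that $F$ has non-uniform fibres. Then, with $f_1,f_2,f_3,g_1,g_2,g_3$ the functions on $(0,1)$ defined in the context, the Assouad spectrum of $F$ is $$\dim_{\mathrm A}^{\theta}F=\begin{cases} f_1(\theta) & \text{for } 0<\theta\le\frac{\log n_1}{\log n_3},\\ f_2(\theta) & \text{for } \frac{\log n_1}{\log n_3}<\theta\le\frac{\log n_1}{\log n_2},\\ f_3(\theta) & \text{for } \frac{\log n_1}{\log n_2}<\theta\le\frac{\log n_2}{\log n_3},\\ \dim_{\mathrm A}F & \text{for } \frac{\log n_2}{\log n_3}<\theta<1,\end{cases}$$ and the lower spectrum of $F$ is $$\dim_{\mathrm L}^{\theta}F=\begin{cases} g_1(\theta) & \text{for } 0<\theta\le\frac{\log n_1}{\log n_3},\\ g_2(\theta) & \text{for } \frac{\log n_1}{\log n_3}<\theta\le\frac{\log n_1}{\log n_2},\\ g_3(\theta) & \text{for } \frac{\log n_1}{\log n_2}<\theta\le\frac{\log n_2}{\log n_3},\\ \dim_{\mathrm L}F & \text{for } \frac{\log n_2}{\log n_3}<\theta<1.\end{cases}$$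
   Context: **Dimensions.** For bounded $E\subset\mathbb{R}^d$ and $r>0$, $N(E,r)$ is the minimal number of balls of radius $r$ required to cover $E$; $B(x,R)$ is the closed ball with centre $x$ and radius $R$. Let $F\subset\mathbb{R}^d$ be non-empty and compact. - Box dimension: $\dim_{\mathrm B}F=\lim_{r\to0}\frac{\log N(F,r)}{\log(1/r)}$ when the limit exists (it does for Bedford--McMullen sponges). - Assouad dimension: $\dim_{\mathrm A}F$ is the infimum of all $s>0$ for which there is $C>0$ such that $N(B(x,R)\cap F,r)\le C(R/r)^s$ for all $x\in F$ and $0<r<R$. - Lower dimension: $\dim_{\mathrm L}F$ is the supremum of all $s>0$ for which there is $C>0$ such that $N(B(x,R)\cap F,r)\ge C(R/r)^s$ for all $x\in F$ and $0<r<R<1$. - For $\theta\in(0,1)$, the Assouad spectrum $\dim_{\mathrm A}^{\theta}F$ is the infimum of all $s>0$ for which there is $C>0$ such that $N(B(x,R)\cap F,R^{1/\theta})\le C(R/R^{1/\theta})^s$ for all $0<R<1$ and $x\in F$. - For $\theta\in(0,1)$, the lower spectrum $\dim_{\mathrm L}^{\theta}F$ is the supremum of all $s>0$ for which there is $C>0$ such that $N(B(x,R)\cap F,R^{1/\theta})\ge C(R/R^{1/\theta})^s$ for all $0<R<1$ and $x\in F$. The supremum of the empty set is taken to be $0$. **Bedford--McMullen sponges.** Let $2\le n_1<\dots<n_d$ be integers, $\mathcal{I}_q=\{0,\dots,n_q-1\}$, and let $\mathcal{D}\subset\prod_{q=1}^d\mathcal{I}_q$ have at least two elements. For $\bar\imath=(i_1,\dots,i_d)\in\mathcal{D}$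 let $\varphi_{\bar\imath}(x_1,\dots,x_d)=\left(\frac{x_1+i_1}{n_1},\dots,\frac{x_d+i_d}{n_d}\right)$ on $[0,1]^d$. Let $\mathcal{D}^\infty$ be the set of infinite words $\omega=(\bar\imath_1,\bar\imath_2,\dots)$ over $\mathcal{D}$ and $\Pi(\omega)$ the unique point of $\bigcap_{l\in\mathbb{N}}\varphi_{\bar\imath_1}\circ\cdots\circ\varphi_{\bar\imath_l}([0,1]^d)$. The Bedford--McMullen sponge generated by $\mathcal{D}$ is $F=\Pi(\mathcal{D}^\infty)$. For $1\le l\le d$, $\pi_l$ denotes projection of $\mathcal{D}$ onto the first $l$ coordinates, and for $1\le l\le d-1$ and $(i_1,\dots,i_l)\in\pi_l\mathcal{D}$, $$N(i_1,\dots,i_l)=|\{i_{l+1}\in\mathcal{I}_{l+1}:(i_1,\dots,i_l,i_{l+1})\in\pi_{l+1}\mathcal{D}\}|.$$ $F$ has uniform fibres if for every $l=1,\dots,d-1$ the number $N(i_1,\dots,i_l)$ is the same for all $(i_1,\dots,i_l)\in\pi_l\mathcal{D}$; otherwise it has non-uniform fibres. **Notation for $d=3$.** $M_{\max}$, $M_{\min}$ are the maximum and minimum of $N(i_1)$ over $i_1\in\pi_1\mathcal{D}$; $N_{\max}$, $N_{\min}$ are the maximum and minimum of $N(i_1,i_2)$ over $(i_1,i_2)\in\pi_2\mathcal{D}$; $C_{\max}$, $C_{\min}$ are the maximum and minimum over $i_1\in\pi_1\mathcal{D}$ of $\sum_{i_2:(i_1,i_2)\in\pi_2\mathcal{D}}N(i_1,i_2)$.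 For $\theta\in(0,1)$, $$f_1(\theta)=\frac{\dim_{\mathrm B}F-\theta\left(\frac{\log(|\mathcal{D}|/C_{\max})}{\log n_1}+\frac{\log(C_{\max}/N_{\max})}{\log n_2}+\frac{\log N_{\max}}{\log n_3}\right)}{1-\theta},$$ $$f_2(\theta)=\frac{\frac{\log|\pi_1\mathcal{D}|}{\log n_1}+\frac{\log(|\pi_2\mathcal{D}|/|\pi_1\mathcal{D}|)}{\log n_2}+\frac{\log(C_{\max}/M_{\max})}{\log n_3}-\theta\left(\frac{\log(|\pi_2\mathcal{D}|/M_{\max})}{\log n_1}+\frac{\log(C_{\max}/N_{\max})}{\log n_2}+\frac{\log N_{\max}}{\log n_3}\right)}{1-\theta},$$ $$f_3(\theta)=\frac{\log|\pi_1\mathcal{D}|}{\log n_1}+\frac{\frac{\log M_{\max}}{\log n_2}+\frac{\log(C_{\max}/M_{\max})}{\log n_3}-\theta\left(\frac{\log(C_{\max}/N_{\max})}{\log n_2}+\frac{\log N_{\max}}{\log n_3}\right)}{1-\theta},$$ and $g_1,g_2,g_3$ are given by the same formulae as $f_1,f_2,f_3$ respectively, with $C_{\max},M_{\max},N_{\max}$ replaced throughout by $C_{\min},M_{\min},N_{\min}$. *)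

theory Defs
  imports "HOL-Analysis.Analysis"
begin

section \<open>Dimensions\<close>

text \<open>The covering balls are closed, and their centres need not belong to the covered set.
  For unbounded sets the value is of no significance.\<close>

definition covering_number :: "'a::euclidean_space set \<Rightarrow> real \<Rightarrow> nat" where
  "covering_number E r =
     (LEAST k. \<exists>T. finite T \<and> card T = k \<and> E \<subseteq> (\<Union>x\<in>T. cball x r))"

definition box_dim :: "'a::euclidean_space set \<Rightarrow> real" where
  "box_dim F = Lim (at_right 0) (\<lambda>r. ln (real (covering_number F r)) / ln (1 / r))"

definition assouad_dim :: "'a::euclidean_space set \<Rightarrow> real" where
  "assouad_dim F = Inf {s. s > 0 \<and> (\<exists>C>0. \<forall>x\<in>F. \<forall>R r. 0 < r \<and> r < R \<longrightarrow>
     real (covering_number (cball x R \<inter> F) r) \<le> C * (R / r) powr s)}"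

definition assouad_spectrum :: "real \<Rightarrow> 'a::euclidean_space set \<Rightarrow> real" where
  "assouad_spectrum \<theta> F = Inf {s. s > 0 \<and> (\<exists>C>0. \<forall>R. \<forall>x\<in>F. 0 < R \<and> R < 1 \<longrightarrow>
     real (covering_number (cball x R \<inter> F) (R powr (1 / \<theta>)))
       \<le> C * (R / R powr (1 / \<theta>)) powr s)}"

text \<open>The library leaves the supremum of the empty set of reals unspecified.\<close>

definition Sup0 :: "real set \<Rightarrow> real" where
  "Sup0 S = (if S = {} then 0 else Sup S)"

definition lower_dim :: "'a::euclidean_space set \<Rightarrow> real" where
  "lower_dim F = Sup0 {s. s > 0 \<and> (\<exists>C>0. \<forall>x\<in>F. \<forall>R r. 0 < r \<and> r < R \<and> R < 1 \<longrightarrow>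
     real (covering_number (cball x R \<inter> F) r) \<ge> C * (R / r) powr s)}"

definition lower_spectrum :: "real \<Rightarrow> 'a::euclidean_space set \<Rightarrow> real" where
  "lower_spectrum \<theta> F = Sup0 {s. s > 0 \<and> (\<exists>C>0. \<forall>R. \<forall>x\<in>F. 0 < R \<and> R < 1 \<longrightarrow>
     real (covering_number (cball x R \<inter> F) (R powr (1 / \<theta>)))
       \<ge> C * (R / R powr (1 / \<theta>)) powr s)}"


section \<open>Bedford--McMullen sponges\<close>

definition digit_box :: "nat ^ 'd \<Rightarrow> (nat ^ 'd) set" where
  "digit_box n = {i. \<forall>q. i $ q < n $ q}"

definition sponge_map :: "nat ^ 'd \<Rightarrow> nat ^ 'd \<Rightarrow> real ^ 'd \<Rightarrow> real ^ 'd" where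
  "sponge_map n i x = (\<chi> q. (x $ q + real (i $ q)) / real (n $ q))"

text \<open>Words are indexed from 0, so \<open>sponge_comp n w l\<close> is the composition, in this order, of the
  maps of the first \<open>l\<close> letters \<open>w 0, ..., w (l - 1)\<close>.\<close>

primrec sponge_comp :: "nat ^ 'd \<Rightarrow> (nat \<Rightarrow> nat ^ 'd) \<Rightarrow> nat \<Rightarrow> real ^ 'd \<Rightarrow> real ^ 'd" where
  "sponge_comp n w 0 = id"
| "sponge_comp n w (Suc l) = sponge_comp n w l \<circ> sponge_map n (w l)"

definition coding_map :: "nat ^ 'd \<Rightarrow> (nat \<Rightarrow> nat ^ 'd) \<Rightarrow> real ^ 'd" where
  "coding_map n w =
     (THE x. x \<in> (\<Inter>l. sponge_comp n w l ` {y. \<forall>q. 0 \<le> y $ q \<and> y $ q \<le> 1}))"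

definition sponge :: "nat ^ 'd \<Rightarrow> (nat ^ 'd) set \<Rightarrow> (real ^ 'd) set" where
  "sponge n D = coding_map n ` {w. \<forall>l. w l \<in> D}"


section \<open>Digit sets in three dimensions\<close>

definition proj1 :: "(nat ^ 3) set \<Rightarrow> nat set" where
  "proj1 D = (\<lambda>i. i $ 1) ` D"

definition proj2 :: "(nat ^ 3) set \<Rightarrow> (nat \<times> nat) set" where
  "proj2 D = (\<lambda>i. (i $ 1, i $ 2)) ` D"

definition fibre1 :: "nat ^ 3 \<Rightarrow> (nat ^ 3) set \<Rightarrow> nat \<Rightarrow> nat" where
  "fibre1 n D i1 = card {i2. i2 < n $ 2 \<and> (i1, i2) \<in> proj2 D}"

definition fibre2 :: "nat ^ 3 \<Rightarrow> (nat ^ 3) set \<Rightarrow> nat \<times> nat \<Rightarrow> nat" where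
  "fibre2 n D = (\<lambda>(i1, i2). card {i3. i3 < n $ 3 \<and> vector [i1, i2, i3] \<in> D})"

definition uniform_fibres :: "nat ^ 3 \<Rightarrow> (nat ^ 3) set \<Rightarrow> bool" where
  "uniform_fibres n D \<longleftrightarrow>
     (\<forall>a\<in>proj1 D. \<forall>b\<in>proj1 D. fibre1 n D a = fibre1 n D b) \<and>
     (\<forall>a\<in>proj2 D. \<forall>b\<in>proj2 D. fibre2 n D a = fibre2 n D b)"

definition column_sum :: "nat ^ 3 \<Rightarrow> (nat ^ 3) set \<Rightarrow> nat \<Rightarrow> nat" where
  "column_sum n D i1 = (\<Sum>i2 | (i1, i2) \<in> proj2 D. fibre2 n D (i1, i2))"

definition M_max :: "nat ^ 3 \<Rightarrow> (nat ^ 3) set \<Rightarrow> nat" where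
  "M_max n D = Max (fibre1 n D ` proj1 D)"

definition M_min :: "nat ^ 3 \<Rightarrow> (nat ^ 3) set \<Rightarrow> nat" where
  "M_min n D = Min (fibre1 n D ` proj1 D)"

definition N_max :: "nat ^ 3 \<Rightarrow> (nat ^ 3) set \<Rightarrow> nat" where
  "N_max n D = Max (fibre2 n D ` proj2 D)"

definition N_min :: "nat ^ 3 \<Rightarrow> (nat ^ 3) set \<Rightarrow> nat" where
  "N_min n D = Min (fibre2 n D ` proj2 D)"

definition C_max :: "nat ^ 3 \<Rightarrow> (nat ^ 3) set \<Rightarrow> nat" where
  "C_max n D = Max (column_sum n D ` proj1 D)"

definition C_min :: "nat ^ 3 \<Rightarrow> (nat ^ 3) set \<Rightarrow> nat" where
  "C_min n D = Min (column_sum n D ` proj1 D)"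


section \<open>The formulae for the spectra\<close>

text \<open>The formulae for the Assouad spectrum and for the lower spectrum differ only in the values
  \<open>C\<close>, \<open>M\<close>, \<open>N\<close>: maxima for \<open>f1\<close>, \<open>f2\<close>, \<open>f3\<close>, minima for \<open>g1\<close>, \<open>g2\<close>, \<open>g3\<close>.\<close>

definition formula1 :: "nat ^ 3 \<Rightarrow> (nat ^ 3) set \<Rightarrow> real \<Rightarrow> real \<Rightarrow> real \<Rightarrow> real" where
  "formula1 n D C N \<theta> =
     (box_dim (sponge n D)
       - \<theta> * (ln (card D / C) / ln (n $ 1) + ln (C / N) / ln (n $ 2) + ln N / ln (n $ 3)))
     / (1 - \<theta>)"

definition formula2 :: "nat ^ 3 \<Rightarrow> (nat ^ 3) set \<Rightarrow> real \<Rightarrow> real \<Rightarrow> real \<Rightarrow> real \<Rightarrow> real" where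
  "formula2 n D C M N \<theta> =
     (ln (card (proj1 D)) / ln (n $ 1) + ln (card (proj2 D) / card (proj1 D)) / ln (n $ 2)
         + ln (C / M) / ln (n $ 3)
       - \<theta> * (ln (card (proj2 D) / M) / ln (n $ 1) + ln (C / N) / ln (n $ 2) + ln N / ln (n $ 3)))
     / (1 - \<theta>)"

definition formula3 :: "nat ^ 3 \<Rightarrow> (nat ^ 3) set \<Rightarrow> real \<Rightarrow> real \<Rightarrow> real \<Rightarrow> real \<Rightarrow> real" where
  "formula3 n D C M N \<theta> =
     ln (card (proj1 D)) / ln (n $ 1)
     + (ln M / ln (n $ 2) + ln (C / M) / ln (n $ 3)
         - \<theta> * (ln (C / N) / ln (n $ 2) + ln N / ln (n $ 3)))
       / (1 - \<theta>)"

definition f1 :: "nat ^ 3 \<Rightarrow> (nat ^ 3) set \<Rightarrow> real \<Rightarrow> real" where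
  "f1 n D = formula1 n D (C_max n D) (N_max n D)"

definition f2 :: "nat ^ 3 \<Rightarrow> (nat ^ 3) set \<Rightarrow> real \<Rightarrow> real" where
  "f2 n D = formula2 n D (C_max n D) (M_max n D) (N_max n D)"

definition f3 :: "nat ^ 3 \<Rightarrow> (nat ^ 3) set \<Rightarrow> real \<Rightarrow> real" where
  "f3 n D = formula3 n D (C_max n D) (M_max n D) (N_max n D)"

definition g1 :: "nat ^ 3 \<Rightarrow> (nat ^ 3) set \<Rightarrow> real \<Rightarrow> real" where
  "g1 n D = formula1 n D (C_min n D) (N_min n D)"

definition g2 :: "nat ^ 3 \<Rightarrow> (nat ^ 3) set \<Rightarrow> real \<Rightarrow> real" where
  "g2 n D = formula2 n D (C_min n D) (M_min n D) (N_min n D)"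

definition g3 :: "nat ^ 3 \<Rightarrow> (nat ^ 3) set \<Rightarrow> real \<Rightarrow> real" where
  "g3 n D = formula3 n D (C_min n D) (M_min n D) (N_min n D)"

end

theory Submission
  imports Defs
begin

text \<open>
  The sponge is coded by words over \<open>D\<close>. A ball of radius \<open>R\<close> is comparable to an approximate cube: the
  words agreeing with a given one in about \<open>ln (1 / R) / ln (n $ q)\<close> digits of coordinate \<open>q\<close>. Covering
  it at scale \<open>r\<close> amounts to resolving about \<open>ln (1 / r) / ln (n $ q)\<close> digits, so the covering number is
  comparable to a product over the positions of a word: each position contributes the number of ways
  to resolve certain coordinates of its letter when certain others are fixed. The positions are
  independent, so the extremal covering numbers arise by extremising every factor, and the spectra
  are piecewise rational in the parameter because the order of the six levels changes only at the
  three break points. Beyond the last one the ranges belonging to the three coordinates are disjoint,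
  which is also the extremal configuration for the Assouad and the lower dimension.
\<close>

section \<open>Covering numbers and the spectra\<close>

text \<open>A ball contains one approximate cube and meets boundedly many, so three of the four
  estimates pass from cubes to balls at the cost of constants. The fourth, an upper bound for one
  well-chosen ball, is the obstacle: the cube around its centre may be poor while a neighbouring
  cube is exponentially richer. The centre must therefore stay away from the boundary of its cube,
  which is enforced by two prescribed digits per coordinate. These digits occupy distinct positions
  only when the coarse levels are well separated, so this estimate holds for small \<open>R\<close>
  only; that suffices for exponents. Every other error is a bounded shift of the levels, which
  changes the product by at most a bounded power of \<open>card D\<close>.

  For the dimensions all pairs of scales occur. Branch numbers that resolve several coordinates at
  once are split into steps of one coordinate: maxima are submultiplicative and minima
  supermultiplicative, which gives one bound on each dimension. The opposite bound is the spectrum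
  in its last range, so no further points have to be constructed.\<close>

lemma covering_number_le:
  assumes "finite T" "E \<subseteq> (\<Union>x\<in>T. cball x r)"
  shows "covering_number E r \<le> card T"
  unfolding covering_number_def using assms by (intro Least_le) auto

text \<open>The closure is compact, hence totally bounded. So finite covers exist and the
  \<open>LEAST\<close> in the definition is attained.\<close>

lemma covering_number_cover:
  fixes E :: "'a::euclidean_space set"
  assumes "bounded E" "r > 0"
  obtains T where "finite T" "card T = covering_number E r" "E \<subseteq> (\<Union>x\<in>T. cball x r)"
proof -
  have "compact (closure E)"
    using assms by (simp add: compact_closure)
  then obtain T where "finite T" "closure E \<subseteq> (\<Union>x\<in>T. ball x r)"
    using assms(2) unfolding compact_eq_totally_bounded by auto
  then have "E \<subseteq> (\<Union>x\<in>T. cball x r)"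
    using closure_subset[of E] ball_subset_cball[of _ r] by blast
  with \<open>finite T\<close> have "\<exists>k T. finite T \<and> card T = k \<and> E \<subseteq> (\<Union>x\<in>T. cball x r)"
    by blast
  from LeastI_ex[OF this] that show thesis
    unfolding covering_number_def by blast
qed

lemma ratio_powr_scale:
  assumes "0 < \<theta>" "\<theta> < 1" "0 < R" "R < (1::real)"
  shows "R / R powr (1 / \<theta>) = R powr (1 - 1 / \<theta>)" "1 < R / R powr (1 / \<theta>)"
    "0 < R powr (1 / \<theta>)" "R powr (1 / \<theta>) < R"
proof -
  show 1: "R / R powr (1 / \<theta>) = R powr (1 - 1 / \<theta>)"
    using assms by (simp add: powr_diff)
  have "1 - 1 / \<theta> < 0" using assms by simp
  then show 2: "1 < R / R powr (1 / \<theta>)"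
    unfolding 1 using assms powr_less_mono2_neg[of "1 - 1/\<theta>" R 1] by simp
  show 3: "0 < R powr (1 / \<theta>)" using assms by simp
  show "R powr (1 / \<theta>) < R" using 2 3 by (simp add: field_simps)
qed

text \<open>The ratio of scales tends to infinity as \<open>R\<close> tends to 0, so constants
  cannot compensate for a larger exponent. Only \<open>R < R0\<close> is tested, because one of the
  later estimates is available for small radii only.\<close>

lemma powr_exponent_le:
  fixes \<theta> R0 c C v s :: real
  assumes \<theta>: "0 < \<theta>" "\<theta> < 1" and "R0 > 0" "c > 0"
    and bd: "\<And>R. 0 < R \<Longrightarrow> R < R0 \<Longrightarrow> R < 1 \<Longrightarrow>
      c * (R / R powr (1 / \<theta>)) powr v \<le> C * (R / R powr (1 / \<theta>)) powr s"
  shows "v \<le> s"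
proof (rule ccontr)
  assume "\<not> v \<le> s"
  define p where "p = (1 / \<theta> - 1) * (v - s)"
  have p: "p > 0"
    using \<theta> \<open>\<not> v \<le> s\<close> unfolding p_def by (intro mult_pos_pos) (auto simp: field_simps)
  \<comment> \<open>Large enough that \<open>R = exp (- t)\<close> is below 1 and \<open>R0\<close>
    and that \<open>t * p\<close> is at least \<open>C / c\<close>; then
    \<open>1 + t * p \<le> exp (t * p)\<close> contradicts the assumed bound.\<close>
  define t where "t = max (\<bar>C / c\<bar> / p) (max 1 (1 - ln R0))"
  define R where "R = exp (- t)"
  have "R < 1" "0 < R" by (auto simp: R_def t_def)
  have "R < exp (ln R0)" unfolding R_def exp_less_cancel_iff t_def by linarith
  then have "R < R0" using \<open>R0 > 0\<close> by simp
  let ?q = "R / R powr (1 / \<theta>)"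
  have q: "?q > 1" "?q = R powr (1 - 1 / \<theta>)"
    using ratio_powr_scale[OF \<theta> \<open>0 < R\<close> \<open>R < 1\<close>] by auto
  have "?q powr (v - s) \<le> C / c"
  proof -
    have "?q powr s > 0" using q(1) \<open>0 < R\<close> by simp
    then show ?thesis
      using bd[OF \<open>0 < R\<close> \<open>R < R0\<close> \<open>R < 1\<close>] \<open>c > 0\<close> unfolding powr_diff
      by (simp only: pos_divide_le_eq pos_le_divide_eq times_divide_eq_left) (simp only: mult.commute)
  qed
  moreover have "?q powr (v - s) = exp (t * p)"
    unfolding q(2) by (simp add: powr_powr) (simp add: powr_def R_def p_def field_simps \<open>0 < \<theta>\<close>)
  moreover have "\<bar>C / c\<bar> \<le> t * p"
    using p unfolding t_def by (simp add: pos_divide_le_eq[symmetric])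
  moreover have "1 + t * p \<le> exp (t * p)" by (rule exp_ge_add_one_self)
  ultimately show False by linarith
qed

text \<open>Admissible exponents are positive by definition, so for \<open>v = 0\<close> the infimum
  is not attained. It is therefore approached through \<open>v + e\<close>.\<close>

lemma assouad_spectrum_eqI:
  fixes F :: "'a::euclidean_space set"
  assumes \<theta>: "0 < \<theta>" "\<theta> < 1" and "c > 0" "C > 0" "v \<ge> 0"
    and upper: "\<And>R x. 0 < R \<Longrightarrow> R < 1 \<Longrightarrow> x \<in> F \<Longrightarrow>
      real (covering_number (cball x R \<inter> F) (R powr (1 / \<theta>))) \<le> C * (R / R powr (1 / \<theta>)) powr v"
    and lower: "\<And>R. 0 < R \<Longrightarrow> R < 1 \<Longrightarrow> \<exists>x\<in>F.
      c * (R / R powr (1 / \<theta>)) powr v \<le> real (covering_number (cball x R \<inter> F) (R powr (1 / \<theta>)))"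
  shows "assouad_spectrum \<theta> F = v"
proof -
  define S where "S = {s. s > 0 \<and> (\<exists>C>0. \<forall>R. \<forall>x\<in>F. 0 < R \<and> R < 1 \<longrightarrow>
     real (covering_number (cball x R \<inter> F) (R powr (1 / \<theta>))) \<le> C * (R / R powr (1 / \<theta>)) powr s)}"
  have ge: "v \<le> s" if "s \<in> S" for s
  proof -
    from that[unfolded S_def] obtain C' where C': "\<And>R x. x \<in> F \<Longrightarrow> 0 < R \<Longrightarrow> R < 1 \<Longrightarrow>
       real (covering_number (cball x R \<inter> F) (R powr (1 / \<theta>))) \<le> C' * (R / R powr (1 / \<theta>)) powr s"
      by blast
    have "c * (R / R powr (1 / \<theta>)) powr v \<le> C' * (R / R powr (1 / \<theta>)) powr s" if "0 < R" "R < 1" for R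
      using lower[OF that] C' that by (meson order_trans)
    then show ?thesis
      using powr_exponent_le[OF \<theta>, of 1 c v C' s] \<open>c > 0\<close> by auto
  qed
  have mem: "s \<in> S" if "s > 0" "s \<ge> v" for s
  proof -
    have "real (covering_number (cball x R \<inter> F) (R powr (1 / \<theta>))) \<le> C * (R / R powr (1 / \<theta>)) powr s"
      if "x \<in> F" "0 < R" "R < 1" for R x
      using upper[OF that(2,3,1)] ratio_powr_scale(2)[OF \<theta> that(2,3)] \<open>C > 0\<close> \<open>s \<ge> v\<close>
      by (elim order_trans) (intro mult_left_mono powr_mono; simp)
    with \<open>s > 0\<close> \<open>C > 0\<close> show ?thesis unfolding S_def by blast
  qed
  have "Inf S = v"
  proof (rule antisym)
    show "Inf S \<le> v"
    proof (rule field_le_epsilon)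
      fix e :: real assume "e > 0"
      then show "Inf S \<le> v + e"
        using mem[of "v + e"] ge \<open>v \<ge> 0\<close> by (intro cInf_lower bdd_belowI[of _ v]) auto
    qed
    show "v \<le> Inf S"
      using mem[of "v + 1"] \<open>v \<ge> 0\<close> by (intro cInf_greatest ge) auto
  qed
  then show ?thesis by (simp add: assouad_spectrum_def S_def)
qed

lemma lower_spectrum_eqI:
  fixes F :: "'a::euclidean_space set"
  assumes \<theta>: "0 < \<theta>" "\<theta> < 1" and "c > 0" "C > 0" "v \<ge> 0" "R0 > 0"
    and lower: "\<And>R x. 0 < R \<Longrightarrow> R < 1 \<Longrightarrow> x \<in> F \<Longrightarrow>
      c * (R / R powr (1 / \<theta>)) powr v \<le> real (covering_number (cball x R \<inter> F) (R powr (1 / \<theta>)))"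
    and upper: "\<And>R. 0 < R \<Longrightarrow> R < R0 \<Longrightarrow> R < 1 \<Longrightarrow> \<exists>x\<in>F.
      real (covering_number (cball x R \<inter> F) (R powr (1 / \<theta>))) \<le> C * (R / R powr (1 / \<theta>)) powr v"
  shows "lower_spectrum \<theta> F = v"
proof -
  define S where "S = {s. s > 0 \<and> (\<exists>C>0. \<forall>R. \<forall>x\<in>F. 0 < R \<and> R < 1 \<longrightarrow>
     real (covering_number (cball x R \<inter> F) (R powr (1 / \<theta>))) \<ge> C * (R / R powr (1 / \<theta>)) powr s)}"
  have spec: "lower_spectrum \<theta> F = Sup0 S" by (simp add: lower_spectrum_def S_def)
  have le: "s \<le> v" if "s \<in> S" for s
  proof -
    from that[unfolded S_def] obtain c' where c': "c' > 0" "\<And>R x. x \<in> F \<Longrightarrow> 0 < R \<Longrightarrow> R < 1 \<Longrightarrow>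
       real (covering_number (cball x R \<inter> F) (R powr (1 / \<theta>))) \<ge> c' * (R / R powr (1 / \<theta>)) powr s"
      by blast
    have "c' * (R / R powr (1 / \<theta>)) powr s \<le> C * (R / R powr (1 / \<theta>)) powr v" if "0 < R" "R < R0" "R < 1" for R
      using upper[OF that] c' that by (meson order_trans)
    then show ?thesis
      using powr_exponent_le[OF \<theta> \<open>R0 > 0\<close> c'(1), of s C v] by auto
  qed
  have mem: "v \<in> S" if "v > 0"
    unfolding S_def using lower \<open>c > 0\<close> that by blast
  show ?thesis
  proof (cases "v > 0")
    case True
    then have "Sup S = v" using mem le by (intro cSup_eq_maximum) auto
    then show ?thesis using mem[OF True] by (auto simp: spec Sup0_def)
  next
    case False
    \<comment> \<open>For \<open>v = 0\<close> no positive exponent is admissible, and the value 0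
      comes from the convention in \<open>Sup0\<close>.\<close>
    have "s \<notin> S" for s using le[of s] False \<open>v \<ge> 0\<close> unfolding S_def by auto
    then have "S = {}" by blast
    then show ?thesis using False \<open>v \<ge> 0\<close> by (simp add: spec Sup0_def)
  qed
qed

text \<open>The spectrum tests only the pairs \<open>R\<close>, \<open>R powr (1 / \<theta>)\<close>
  among all pairs of scales, so it has more admissible exponents. The assumed bound makes the
  smaller set nonempty, as monotonicity of \<open>Inf\<close> requires.\<close>

lemma assouad_spectrum_le_assouad_dim:
  fixes F :: "'a::euclidean_space set"
  assumes \<theta>: "0 < \<theta>" "\<theta> < 1" and "C > 0" "v \<ge> 0"
    and upper: "\<And>R r x. 0 < r \<Longrightarrow> r < R \<Longrightarrow> x \<in> F \<Longrightarrow>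
      real (covering_number (cball x R \<inter> F) r) \<le> C * (R / r) powr v"
  shows "assouad_spectrum \<theta> F \<le> assouad_dim F" "assouad_dim F \<le> v"
proof -
  define S where "S = {s. s > 0 \<and> (\<exists>C>0. \<forall>R. \<forall>x\<in>F. 0 < R \<and> R < 1 \<longrightarrow>
     real (covering_number (cball x R \<inter> F) (R powr (1 / \<theta>))) \<le> C * (R / R powr (1 / \<theta>)) powr s)}"
  define A where "A = {s. s > 0 \<and> (\<exists>C>0. \<forall>x\<in>F. \<forall>R r. 0 < r \<and> r < R \<longrightarrow>
     real (covering_number (cball x R \<inter> F) r) \<le> C * (R / r) powr s)}"
  have sub: "A \<subseteq> S"
  proof
    fix s assume sA: "s \<in> A"
    from sA[unfolded A_def] obtain C where "s > 0" "C > 0" and C: "\<And>x R r. x \<in> F \<Longrightarrow> 0 < r \<Longrightarrow> r < R \<Longrightarrow>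
      real (covering_number (cball x R \<inter> F) r) \<le> C * (R / r) powr s" by blast
    then show "s \<in> S"
      unfolding S_def using C[OF _ ratio_powr_scale(3,4)[OF \<theta>]] by blast
  qed
  have mem: "s \<in> A" if "s > 0" "s \<ge> v" for s
  proof -
    have "real (covering_number (cball x R \<inter> F) r) \<le> C * (R / r) powr s"
      if "x \<in> F" "0 < r" "r < R" for R r x
      using upper[OF that(2,3,1)] that \<open>C > 0\<close> \<open>s \<ge> v\<close>
      by (elim order_trans) (intro mult_left_mono powr_mono; simp)
    with \<open>s > 0\<close> \<open>C > 0\<close> show ?thesis unfolding A_def by blast
  qed
  have bdd: "bdd_below S" "bdd_below A"
    by (auto simp: S_def A_def intro!: bdd_belowI[of _ 0])
  have "v + 1 \<in> A" using mem[of "v + 1"] \<open>v \<ge> 0\<close> by simp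
  then have "Inf S \<le> Inf A"
    using sub bdd by (intro cInf_superset_mono) auto
  then show "assouad_spectrum \<theta> F \<le> assouad_dim F"
    by (simp add: assouad_spectrum_def assouad_dim_def S_def A_def)
  have "Inf A \<le> v"
  proof (rule field_le_epsilon)
    fix e :: real assume "e > 0"
    then show "Inf A \<le> v + e"
      using mem[of "v + e"] \<open>v \<ge> 0\<close> bdd by (intro cInf_lower) auto
  qed
  then show "assouad_dim F \<le> v" by (simp add: assouad_dim_def A_def)
qed

text \<open>The upper bound on covering numbers makes the set in the definition of the lower spectrum
  bounded, without which its supremum would be a junk value.\<close>

lemma lower_dim_le_lower_spectrum:
  fixes F :: "'a::euclidean_space set"
  assumes \<theta>: "0 < \<theta>" "\<theta> < 1" and "c > 0" "v \<ge> 0" "F \<noteq> {}"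
    and lower: "\<And>R r x. 0 < r \<Longrightarrow> r < R \<Longrightarrow> R < 1 \<Longrightarrow> x \<in> F \<Longrightarrow>
      c * (R / r) powr v \<le> real (covering_number (cball x R \<inter> F) r)"
    and upper: "\<And>R x. 0 < R \<Longrightarrow> R < 1 \<Longrightarrow> x \<in> F \<Longrightarrow>
      real (covering_number (cball x R \<inter> F) (R powr (1 / \<theta>))) \<le> C * (R / R powr (1 / \<theta>)) powr u"
  shows "lower_dim F \<le> lower_spectrum \<theta> F" "v \<le> lower_dim F"
proof -
  define S where "S = {s. s > 0 \<and> (\<exists>C>0. \<forall>R. \<forall>x\<in>F. 0 < R \<and> R < 1 \<longrightarrow>
     real (covering_number (cball x R \<inter> F) (R powr (1 / \<theta>))) \<ge> C * (R / R powr (1 / \<theta>)) powr s)}"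
  define A where "A = {s. s > 0 \<and> (\<exists>C>0. \<forall>x\<in>F. \<forall>R r. 0 < r \<and> r < R \<and> R < 1 \<longrightarrow>
     real (covering_number (cball x R \<inter> F) r) \<ge> C * (R / r) powr s)}"
  have sub: "A \<subseteq> S"
  proof
    fix s assume sA: "s \<in> A"
    from sA[unfolded A_def] obtain C where "s > 0" "C > 0" and C: "\<And>x R r. x \<in> F \<Longrightarrow> 0 < r \<Longrightarrow> r < R \<Longrightarrow> R < 1 \<Longrightarrow>
      C * (R / r) powr s \<le> real (covering_number (cball x R \<inter> F) r)" by blast
    then show "s \<in> S"
      unfolding S_def using C[OF _ ratio_powr_scale(3,4)[OF \<theta>]] by blast
  qed
  have le: "s \<le> u" if "s \<in> S" for s
  proof -
    from that[unfolded S_def] obtain c' where c': "c' > 0" "\<And>R x. x \<in> F \<Longrightarrow> 0 < R \<Longrightarrow> R < 1 \<Longrightarrow>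
       real (covering_number (cball x R \<inter> F) (R powr (1 / \<theta>))) \<ge> c' * (R / R powr (1 / \<theta>)) powr s"
      by blast
    obtain x where "x \<in> F" using \<open>F \<noteq> {}\<close> by blast
    have "c' * (R / R powr (1 / \<theta>)) powr s \<le> C * (R / R powr (1 / \<theta>)) powr u" if "0 < R" "R < 1" for R
      using upper[OF that \<open>x \<in> F\<close>] c'(2)[OF \<open>x \<in> F\<close> that] by linarith
    then show ?thesis
      using powr_exponent_le[OF \<theta> _ c'(1), of 1 s C u] by auto
  qed
  have mem: "v \<in> A" if "v > 0"
    unfolding A_def using lower \<open>c > 0\<close> that by blast
  have "bdd_above S" using le by (rule bdd_aboveI)
  then have bdd: "bdd_above S" "bdd_above A" using bdd_above_mono[OF _ sub] by simp_all
  have pos: "0 \<le> s" if "s \<in> S \<or> s \<in> A" for s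
    using that by (auto simp: S_def A_def)
  have "Sup0 A \<le> Sup0 S"
  proof (cases "A = {}")
    case True
    have "0 \<le> Sup0 S"
    proof (cases "S = {}")
      case False
      then obtain s where "s \<in> S" by blast
      then have "0 \<le> s" "s \<le> Sup S" using bdd(1) pos by (auto intro: cSup_upper)
      then show ?thesis using False by (simp add: Sup0_def)
    qed (simp add: Sup0_def)
    then show ?thesis using True unfolding Sup0_def by auto
  next
    case False
    then have "S \<noteq> {}" using sub by blast
    then show ?thesis
      using False cSup_subset_mono[OF False bdd(1) sub] by (simp add: Sup0_def)
  qed
  then show "lower_dim F \<le> lower_spectrum \<theta> F"
    by (simp add: lower_spectrum_def lower_dim_def S_def A_def)
  have "v \<le> Sup0 A"
  proof (cases "v > 0")
    case True
    then show ?thesis using mem bdd(2) by (auto simp: Sup0_def intro: cSup_upper)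
  next
    case False
    then have "v = 0" using \<open>v \<ge> 0\<close> by simp
    show ?thesis
    proof (cases "A = {}")
      case ne: False
      then obtain s where "s \<in> A" by blast
      then have "0 \<le> s" "s \<le> Sup A" using bdd(2) pos by (auto intro: cSup_upper)
      then show ?thesis using ne \<open>v = 0\<close> by (simp add: Sup0_def)
    qed (simp add: Sup0_def \<open>v = 0\<close>)
  qed
  then show "v \<le> lower_dim F" by (simp add: lower_dim_def A_def)
qed

section \<open>Digit expansions\<close>

text \<open>Horner's scheme for the numerator of a truncated base \<open>b\<close> expansion. It is
  kept as an integer so that comparing grid cells becomes integer arithmetic.\<close>

primrec prefix_value :: "nat \<Rightarrow> (nat \<Rightarrow> nat) \<Rightarrow> nat \<Rightarrow> nat" where
  "prefix_value b d 0 = 0"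
| "prefix_value b d (Suc l) = b * prefix_value b d l + d l"

lemma prefix_value_inject:
  assumes "\<And>j. d j < b" "\<And>j. e j < b" "prefix_value b d l = prefix_value b e l" "j < l"
  shows "d j = e j"
  using assms(3,4)
proof (induction l)
  case (Suc l)
  have "b > 0" using assms(1)[of 0] by simp
  have "(b * prefix_value b d l + d l) div b = (b * prefix_value b e l + e l) div b"
    "(b * prefix_value b d l + d l) mod b = (b * prefix_value b e l + e l) mod b"
    using Suc.prems(1) by simp_all
  then have "prefix_value b d l = prefix_value b e l" "d l = e l"
    using assms(1)[of l] assms(2)[of l] \<open>b > 0\<close> by simp_all
  with Suc show ?case by (cases "j = l") auto
qed simp

lemma prefix_value_cong:
  assumes "\<And>j. j < l \<Longrightarrow> d j = e j"
  shows "prefix_value b d l = prefix_value b e l"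
  using assms by (induction l) auto

text \<open>Nested intervals: the left ends increase, the right ends decrease, and the supremum of
  the left ends lies in all intervals.\<close>

lemma expansion_exists:
  assumes d: "\<And>j. d j < b"
  shows "\<exists>x::real. \<forall>l. real (prefix_value b d l) / real b ^ l \<le> x \<and>
    x \<le> (real (prefix_value b d l) + 1) / real b ^ l"
proof -
  have b: "real b > 0" using d[of 0] by simp
  define a where "a l = real (prefix_value b d l) / real b ^ l" for l
  define c where "c l = (real (prefix_value b d l) + 1) / real b ^ l" for l
  have a_Suc: "a l \<le> a (Suc l)" for l
    using b by (simp add: a_def field_simps)
  have c_Suc: "c (Suc l) \<le> c l" for l
  proof -
    have "real (d l) + 1 \<le> real b" using d[of l] by linarith
    then show ?thesis using b by (simp add: c_def divide_simps) (simp add: algebra_simps)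
  qed
  have ac: "a l \<le> c m" for l m
  proof -
    have "a l \<le> a (max l m)" by (rule lift_Suc_mono_le[of a]) (auto intro: a_Suc)
    also have "\<dots> \<le> c (max l m)" using b by (simp add: a_def c_def divide_right_mono)
    also have "\<dots> \<le> c m" by (rule lift_Suc_antimono_le[of c]) (auto intro: c_Suc)
    finally show ?thesis .
  qed
  have "a l \<le> (SUP l. a l) \<and> (SUP l. a l) \<le> c l" for l
    using ac by (auto intro!: cSUP_upper cSUP_least bdd_aboveI[of _ "c 0"])
  then show ?thesis unfolding a_def c_def by blast
qed

text \<open>The distance is at most \<open>m\<close> cell widths; the additional 1 accounts for the
  unknown positions of the points inside their closed cells.\<close>

lemma grid_abs_diff_less:
  fixes A A' :: int and m :: nat and N x y :: real
  assumes "N > 0" "A / N \<le> x" "x \<le> (A + 1) / N" "A' / N \<le> y" "y \<le> (A' + 1) / N"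
    and "\<bar>x - y\<bar> \<le> m / N"
  shows "\<bar>A - A'\<bar> \<le> int m + 1"
proof -
  have "A \<le> x * N" "x * N \<le> A + 1" "A' \<le> y * N" "y * N \<le> A' + 1"
    using assms by (simp_all add: field_simps)
  moreover have "\<bar>x * N - y * N\<bar> \<le> m"
    using assms by (simp add: left_diff_distrib[symmetric] abs_mult pos_le_divide_eq)
  ultimately show ?thesis by linarith
qed

text \<open>\<open>f\<close> factors through \<open>g\<close> by a choice of representatives. Only
  the image under \<open>g\<close> is assumed finite, because \<open>W\<close> will be an infinite
  set of words.\<close>

lemma card_image_le_factor:
  assumes "finite (g ` W)" "\<And>x y. x \<in> W \<Longrightarrow> y \<in> W \<Longrightarrow> g x = g y \<Longrightarrow> f x = f y"
  shows "finite (f ` W)" "card (f ` W) \<le> card (g ` W)"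
proof -
  have eq: "f ` W = (\<lambda>t. f (SOME x. x \<in> W \<and> g x = t)) ` g ` W"
    unfolding image_image
  proof (rule image_cong)
    fix x assume "x \<in> W"
    then have "\<exists>y. y \<in> W \<and> g y = g x" by blast
    from someI_ex[OF this] show "f x = f (SOME y. y \<in> W \<and> g y = g x)"
      using assms(2) \<open>x \<in> W\<close> by metis
  qed simp
  show "finite (f ` W)" unfolding eq using assms(1) by (rule finite_imageI)
  show "card (f ` W) \<le> card (g ` W)" unfolding eq using assms(1) by (rule card_image_le)
qed

lemma card_image_le_fibres:
  assumes "finite (g ` W)" "\<And>x. x \<in> W \<Longrightarrow> card (f ` {y \<in> W. g y = g x}) \<le> M"
  shows "card (f ` W) \<le> card (g ` W) * M"
proof -
  have "f ` W = (\<Union>t\<in>g ` W. f ` {y \<in> W. g y = t})" by blast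
  then have "card (f ` W) \<le> (\<Sum>t\<in>g ` W. card (f ` {y \<in> W. g y = t}))"
    using card_UN_le[OF assms(1)] by metis
  also have "\<dots> \<le> card (g ` W) * M"
    using assms(2) sum_bounded_above[of "g ` W" "\<lambda>t. card (f ` {y \<in> W. g y = t})" M] by auto
  finally show ?thesis .
qed

section \<open>Coding of the sponge\<close>

locale digit_sponge =
  fixes n :: "nat ^ 'd" and D :: "(nat ^ 'd) set"
  assumes base_ge_2: "\<And>q. 2 \<le> n $ q" and digits: "D \<subseteq> digit_box n" and nonempty: "D \<noteq> {}"
begin

definition "words = {w :: nat \<Rightarrow> nat ^ 'd. \<forall>j. w j \<in> D}"

definition "pref w q l = prefix_value (n $ q) (\<lambda>j. w j $ q) l"

lemma word_digit: "w \<in> words \<Longrightarrow> w j $ q < n $ q"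
  using digits by (auto simp: words_def digit_box_def)

lemma base_pos: "0 < real (n $ q) ^ l"
  using base_ge_2[of q] by simp

lemma finite_D: "finite D"
proof -
  have "inj_on (\<lambda>i::nat^'d. \<lambda>q\<in>UNIV. i $ q) D"
    by (rule inj_onI) (auto simp: vec_eq_iff fun_eq_iff)
  moreover have "(\<lambda>i. \<lambda>q\<in>UNIV. i $ q) ` D \<subseteq> (\<Pi>\<^sub>E q\<in>UNIV. {..<n $ q})"
    using digits by (fastforce simp: digit_box_def)
  then have "finite ((\<lambda>i. \<lambda>q\<in>UNIV. i $ q) ` D)"
    by (rule finite_subset) (intro finite_PiE; simp)
  ultimately show ?thesis by (rule finite_imageD[rotated])
qed

lemma sponge_comp_nth:
  "sponge_comp n w l y $ q = (real (pref w q l) + y $ q) / real (n $ q) ^ l"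
proof (induction l arbitrary: y)
  case (Suc l)
  have "real (n $ q) \<noteq> 0" using base_ge_2[of q] by auto
  with Suc[of "sponge_map n (w l) y"] show ?case
    by (simp add: sponge_map_def pref_def field_simps)
qed (simp add: pref_def)

lemma mem_sponge_comp_image:
  "x \<in> sponge_comp n w l ` {y. \<forall>q. 0 \<le> y $ q \<and> y $ q \<le> 1} \<longleftrightarrow>
    (\<forall>q. real (pref w q l) / real (n $ q) ^ l \<le> x $ q \<and>
         x $ q \<le> (real (pref w q l) + 1) / real (n $ q) ^ l)" (is "?L \<longleftrightarrow> ?R")
proof
  assume ?L
  then show ?R by (auto simp: sponge_comp_nth intro!: divide_right_mono)
next
  assume R: ?R
  define y where "y = (\<chi> q. x $ q * real (n $ q) ^ l - real (pref w q l))"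
  have "x = sponge_comp n w l y"
    using base_pos by (simp add: vec_eq_iff sponge_comp_nth y_def less_imp_neq[symmetric])
  moreover have "0 \<le> y $ q \<and> y $ q \<le> 1" for q
    using R[rule_format, of q] base_pos[of q l] by (simp add: y_def field_simps)
  ultimately show ?L by blast
qed

text \<open>The boxes intersect in one point: existence holds coordinatewise by nested intervals,
  uniqueness because the sides shrink to 0. This resolves the \<open>THE\<close> in
  \<open>coding_map\<close>; the metric arguments below know the point only through these
  bounds.\<close>

lemma coding_map_bounds:
  assumes "w \<in> words"
  shows "real (pref w q l) / real (n $ q) ^ l \<le> coding_map n w $ q"
    "coding_map n w $ q \<le> (real (pref w q l) + 1) / real (n $ q) ^ l"
proof -
  let ?I = "\<Inter>l. sponge_comp n w l ` {y. \<forall>q. 0 \<le> y $ q \<and> y $ q \<le> 1}"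
  have ex: "\<exists>x::real. \<forall>l. real (pref w q l) / real (n $ q) ^ l \<le> x \<and>
      x \<le> (real (pref w q l) + 1) / real (n $ q) ^ l" for q
    unfolding pref_def by (rule expansion_exists) (rule word_digit[OF assms])
  then obtain X where X: "\<And>q l. real (pref w q l) / real (n $ q) ^ l \<le> X q \<and>
      X q \<le> (real (pref w q l) + 1) / real (n $ q) ^ l"
    by metis
  have mem: "(\<chi> q. X q) \<in> ?I" using X by (simp add: mem_sponge_comp_image)
  have unique: "x = y" if "x \<in> ?I" "y \<in> ?I" for x y
  proof (unfold vec_eq_iff, rule, rule ccontr)
    fix q assume ne: "x $ q \<noteq> y $ q"
    have "(\<lambda>l. (1 / real (n $ q)) ^ l) \<longlonglongrightarrow> 0"
      using base_ge_2[of q] by (intro LIMSEQ_realpow_zero) auto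
    then have "\<forall>\<^sub>F l in sequentially. (1 / real (n $ q)) ^ l < \<bar>x $ q - y $ q\<bar>"
      using ne by (intro order_tendstoD(2)) auto
    then obtain l where l: "(1 / real (n $ q)) ^ l < \<bar>x $ q - y $ q\<bar>"
      by (auto simp: eventually_sequentially)
    have "\<bar>x $ q - y $ q\<bar> \<le> (real (pref w q l) + 1) / real (n $ q) ^ l - real (pref w q l) / real (n $ q) ^ l"
    proof -
      have "x \<in> sponge_comp n w l ` {y. \<forall>q. 0 \<le> y $ q \<and> y $ q \<le> 1}"
        "y \<in> sponge_comp n w l ` {y. \<forall>q. 0 \<le> y $ q \<and> y $ q \<le> 1}"
        using that by blast+
      from this[unfolded mem_sponge_comp_image, rule_format, of q] show ?thesis
        unfolding abs_le_iff by linarith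
    qed
    also have "\<dots> = (1 / real (n $ q)) ^ l"
      by (simp add: diff_divide_distrib[symmetric] power_divide)
    finally show False using l by simp
  qed
  have "coding_map n w \<in> ?I"
    unfolding coding_map_def using mem by (rule theI) (rule unique[OF _ mem])
  then show "real (pref w q l) / real (n $ q) ^ l \<le> coding_map n w $ q"
    "coding_map n w $ q \<le> (real (pref w q l) + 1) / real (n $ q) ^ l"
    by (simp_all add: mem_sponge_comp_image)
qed

lemma sponge_eq: "sponge n D = coding_map n ` words"
  by (simp add: sponge_def words_def)

lemma words_nonempty: "words \<noteq> {}"
  using nonempty by (auto simp: words_def intro!: exI[of _ "\<lambda>_. SOME i. i \<in> D"] some_in_eq[THEN iffD2])

section \<open>Words up to a level\<close>

text \<open>A level prescribes for every coordinate \<open>q\<close> the number \<open>k q\<close> of digits that are resolved;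
  the approximate cubes of level \<open>k\<close> have side length \<open>1 / n $ q ^ k q\<close> in direction \<open>q\<close>.\<close>

definition trunc :: "'d set \<Rightarrow> nat ^ 'd \<Rightarrow> nat ^ 'd" where
  "trunc S i = (\<chi> q. if q \<in> S then i $ q else 0)"

text \<open>Masking the unresolved digits by 0 gives each approximate cube a canonical name, so that
  counting cubes is counting an image.\<close>

definition approx :: "('d \<Rightarrow> nat) \<Rightarrow> (nat \<Rightarrow> nat ^ 'd) \<Rightarrow> nat \<Rightarrow> nat ^ 'd" where
  "approx k w = (\<lambda>j. trunc {q. j < k q} (w j))"

definition cylinder :: "('d \<Rightarrow> nat) \<Rightarrow> (nat \<Rightarrow> nat ^ 'd) \<Rightarrow> (nat \<Rightarrow> nat ^ 'd) set" where
  "cylinder L w = {w' \<in> words. approx L w' = approx L w}"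

text \<open>For ordered levels in three dimensions, \<open>S\<close> and \<open>T\<close> are among
  \<open>{}\<close>, \<open>{1}\<close>, \<open>{1, 2}\<close>, \<open>UNIV\<close>; the extremal
  values are then the cardinalities of \<open>D\<close> and its projections and the numbers
  \<open>M\<close>, \<open>N\<close>, \<open>C\<close> of the formulae.\<close>

definition branch :: "'d set \<Rightarrow> 'd set \<Rightarrow> nat ^ 'd \<Rightarrow> nat" where
  "branch S T i = card (trunc T ` {i' \<in> D. trunc S i' = trunc S i})"

lemma trunc_eq_iff: "trunc S i = trunc S i' \<longleftrightarrow> (\<forall>q\<in>S. i $ q = i' $ q)"
  by (auto simp: trunc_def vec_eq_iff)

lemma approx_eq_iff: "approx k w = approx k w' \<longleftrightarrow> (\<forall>q. \<forall>j<k q. w j $ q = w' j $ q)"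
  by (auto simp: approx_def fun_eq_iff trunc_eq_iff)

lemma approx_eq_iff_pref:
  assumes "w \<in> words" "w' \<in> words"
  shows "approx k w = approx k w' \<longleftrightarrow> (\<forall>q. pref w q (k q) = pref w' q (k q))"
proof
  assume "approx k w = approx k w'"
  then show "\<forall>q. pref w q (k q) = pref w' q (k q)"
    by (auto simp: approx_eq_iff pref_def intro!: prefix_value_cong)
next
  assume "\<forall>q. pref w q (k q) = pref w' q (k q)"
  then show "approx k w = approx k w'"
    unfolding approx_eq_iff pref_def
    by (intro allI impI prefix_value_inject[OF word_digit[OF assms(1)] word_digit[OF assms(2)]]) auto
qed

text \<open>Just a convenient position beyond which no coordinate is resolved, so that all later
  factors would be 1.\<close>

definition height :: "('d \<Rightarrow> nat) \<Rightarrow> nat" where "height k = (\<Sum>q\<in>UNIV. k q)"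

lemma le_height: "k q \<le> height k"
  unfolding height_def by (rule member_le_sum) auto

text \<open>Letters can be exchanged position by position without leaving \<open>words\<close>.
  Hence restriction to the positions below \<open>height k\<close> maps the cubes injectively onto a
  full product of choices.\<close>

lemma card_approx_cylinder:
  assumes "w \<in> words"
  shows "card (approx k ` cylinder L w) = (\<Prod>j<height k. branch {q. j < L q} {q. j < k q} (w j))"
proof -
  define P where "P j = trunc {q. j < k q} ` {i' \<in> D. trunc {q. j < L q} i' = trunc {q. j < L q} (w j)}" for j
  define res where "res f = restrict f {..<height k}" for f :: "nat \<Rightarrow> nat ^ 'd"
  have inj: "inj_on res (approx k ` cylinder L w)"
  proof (rule inj_onI, rule ext)
    fix f g j assume "f \<in> approx k ` cylinder L w" "g \<in> approx k ` cylinder L w" and eq: "res f = res g"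
    then obtain u v where "f = approx k u" "g = approx k v" by blast
    show "f j = g j"
    proof (cases "j < height k")
      case True
      then show ?thesis using fun_cong[OF eq, of j] by (simp add: res_def)
    next
      case False
      then have "{q. j < k q} = {}" using le_height[of k] by (auto simp: not_less intro: order_trans)
      then show ?thesis by (simp add: \<open>f = _\<close> \<open>g = _\<close> approx_def trunc_def)
    qed
  qed
  have "res ` approx k ` cylinder L w = (\<Pi>\<^sub>E j\<in>{..<height k}. P j)"
  proof (intro equalityI subsetI)
    fix f assume "f \<in> res ` approx k ` cylinder L w"
    then obtain v where v: "v \<in> words" "approx L v = approx L w" "f = res (approx k v)"
      by (auto simp: cylinder_def)
    have "trunc {q. j < L q} (v j) = trunc {q. j < L q} (w j)" for j
      using fun_cong[OF v(2), of j] by (simp add: approx_def)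
    then show "f \<in> (\<Pi>\<^sub>E j\<in>{..<height k}. P j)"
      using v(1) by (auto simp: v(3) res_def approx_def P_def words_def)
  next
    fix f assume f: "f \<in> (\<Pi>\<^sub>E j\<in>{..<height k}. P j)"
    then have "\<forall>j<height k. \<exists>i\<in>D. trunc {q. j < L q} i = trunc {q. j < L q} (w j) \<and> f j = trunc {q. j < k q} i"
      by (force simp: P_def PiE_iff)
    then obtain v where v: "\<And>j. j < height k \<Longrightarrow> v j \<in> D \<and>
        trunc {q. j < L q} (v j) = trunc {q. j < L q} (w j) \<and> f j = trunc {q. j < k q} (v j)"
      by metis
    \<comment> \<open>Beyond \<open>height k\<close> the letters of \<open>w\<close> are kept, so
      that the result is a word and still agrees with \<open>w\<close> at level \<open>L\<close>
      there.\<close>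
    define v' where "v' j = (if j < height k then v j else w j)" for j
    have "v' \<in> words" using v assms by (auto simp: words_def v'_def)
    moreover have "approx L v' = approx L w"
      using v by (auto simp: approx_def v'_def fun_eq_iff)
    moreover have "f = res (approx k v')"
    proof
      fix j show "f j = res (approx k v') j"
        using v[of j] PiE_arb[OF f, of j] by (simp add: res_def approx_def v'_def)
    qed
    ultimately show "f \<in> res ` approx k ` cylinder L w"
      by (auto simp: cylinder_def)
  qed
  then have "card (approx k ` cylinder L w) = card (\<Pi>\<^sub>E j\<in>{..<height k}. P j)"
    using card_image[OF inj] by simp
  also have "\<dots> = (\<Prod>j<height k. card (P j))" by (simp add: card_PiE)
  finally show ?thesis by (simp add: P_def branch_def)
qed

text \<open>A cube is determined by its vector of prefix values, which here lies among the integer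
  points of a box with \<open>2 * m + 1\<close> points per side.\<close>

lemma card_approx_pref_le:
  assumes "W \<subseteq> words" "\<And>w q. w \<in> W \<Longrightarrow> \<bar>int (pref w q (k q)) - c q\<bar> \<le> int m"
  shows "finite (approx k ` W)" "card (approx k ` W) \<le> (2 * m + 1) ^ CARD('d)"
proof -
  define g where "g w = (\<lambda>q. int (pref w q (k q)))" for w
  define B where "B = (\<Pi>\<^sub>E q\<in>UNIV. {c q - int m..c q + int m})"
  have "g ` W \<subseteq> B"
  proof (unfold B_def PiE_UNIV_domain, intro image_subsetI Pi_I)
    fix w q assume "w \<in> W"
    from assms(2)[OF this, of q] show "g w q \<in> {c q - int m..c q + int m}"
      by (auto simp: g_def)
  qed
  moreover have fin: "finite B" unfolding B_def by (intro finite_PiE) auto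
  ultimately have g: "finite (g ` W)" "card (g ` W) \<le> card B"
    using finite_subset card_mono by blast+
  have cB: "card B = (2 * m + 1) ^ CARD('d)"
    by (simp add: B_def card_PiE nat_add_distrib nat_mult_distrib)
  have eq: "approx k w = approx k w'" if "w \<in> W" "w' \<in> W" "g w = g w'" for w w'
    using that assms(1) by (subst approx_eq_iff_pref) (auto simp: g_def dest: fun_cong)
  show "finite (approx k ` W)"
    using g(1) eq by (rule card_image_le_factor)
  have "card (approx k ` W) \<le> card (g ` W)"
    using g(1) eq by (rule card_image_le_factor)
  with g(2) cB show "card (approx k ` W) \<le> (2 * m + 1) ^ CARD('d)" by linarith
qed

text \<open>A prefix of length \<open>l\<close> has value below \<open>n $ q ^ l\<close>, so the
  preceding count applies with centre 0 and a crude common radius.\<close>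

lemma finite_approx:
  assumes "W \<subseteq> words"
  shows "finite (approx k ` W)"
proof -
  have "real (pref w q l) \<le> real (n $ q) ^ l" if "w \<in> words" for w q l
  proof -
    have "pref w q l + 1 \<le> (n $ q) ^ l"
    proof (induction l)
      case (Suc l)
      have "pref w q (Suc l) + 1 \<le> n $ q * (pref w q l + 1)"
        using word_digit[OF that, of l q] by (simp add: pref_def)
      also have "\<dots> \<le> n $ q * n $ q ^ l" using Suc by (intro mult_left_mono) auto
      finally show ?case by simp
    qed (simp add: pref_def)
    then show ?thesis by (metis add_leD1 of_nat_le_iff of_nat_power)
  qed
  then have "pref w q (k q) \<le> (\<Sum>q\<in>UNIV. n $ q ^ k q)" if "w \<in> words" for w q
    using that member_le_sum[of q UNIV "\<lambda>q. n $ q ^ k q"]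
    by (metis (mono_tags, lifting) UNIV_I finite le_trans of_nat_le_iff of_nat_power zero_le)
  then show ?thesis
    using assms by (intro card_approx_pref_le[where c = "\<lambda>_. 0" and m = "\<Sum>q\<in>UNIV. n $ q ^ k q"]) (auto simp flip: of_nat_power of_nat_sum)
qed

section \<open>Comparison of covering numbers with numbers of approximate cubes\<close>

lemma coding_map_dist_le:
  assumes "w \<in> words" "w' \<in> words" "pref w q l = pref w' q l"
  shows "\<bar>coding_map n w $ q - coding_map n w' $ q\<bar> \<le> 1 / real (n $ q) ^ l"
  using coding_map_bounds[OF assms(1), of q l] coding_map_bounds[OF assms(2), of q l] assms(3)
  by (simp add: add_divide_distrib abs_le_iff)

text \<open>The factor \<open>CARD('d)\<close> comes from bounding the euclidean norm by the sum of
  the coordinates; the summand \<open>ln 3\<close> in \<open>upper_level\<close> will pay for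
  it.\<close>

lemma cylinder_dist_le:
  assumes "w \<in> words" "w' \<in> words" "approx k w = approx k w'" "\<And>q. real CARD('d) / real (n $ q) ^ k q \<le> r"
  shows "dist (coding_map n w) (coding_map n w') \<le> r"
proof -
  have "norm (coding_map n w - coding_map n w') \<le> (\<Sum>q\<in>UNIV. \<bar>(coding_map n w - coding_map n w') $ q\<bar>)"
    by (rule norm_le_l1_cart)
  also have "\<dots> \<le> (\<Sum>q\<in>(UNIV :: 'd set). r / real CARD('d))"
  proof (rule sum_mono)
    fix q
    have "\<bar>(coding_map n w - coding_map n w') $ q\<bar> \<le> 1 / real (n $ q) ^ k q"
      using coding_map_dist_le[OF assms(1,2)] assms(3) approx_eq_iff_pref[OF assms(1,2)] by simp
    also have "\<dots> \<le> r / real CARD('d)" using assms(4)[of q] by (simp add: field_simps)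
    finally show "\<bar>(coding_map n w - coding_map n w') $ q\<bar> \<le> r / real CARD('d)" .
  qed
  also have "\<dots> = r" by simp
  finally show ?thesis by (simp add: dist_norm)
qed

text \<open>All codes count: a point on the face of a cell may have several, belonging to different
  cubes.\<close>

definition words_in :: "(real ^ 'd) set \<Rightarrow> (nat \<Rightarrow> nat ^ 'd) set" where
  "words_in E = {w \<in> words. coding_map n w \<in> E}"

text \<open>One ball per cube suffices, centred at the point of any word in
  \<open>words_in E\<close> that represents the cube.\<close>

lemma covering_number_le_card_approx:
  assumes "E \<subseteq> sponge n D" "\<And>q. real CARD('d) / real (n $ q) ^ k q \<le> r"
  shows "covering_number E r \<le> card (approx k ` words_in E)"
proof -
  define rep where "rep a = (SOME w. w \<in> words_in E \<and> approx k w = a)" for a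
  let ?T = "(\<lambda>a. coding_map n (rep a)) ` approx k ` words_in E"
  have fin: "finite (approx k ` words_in E)"
    by (rule finite_approx) (auto simp: words_in_def)
  have "E \<subseteq> (\<Union>x\<in>?T. cball x r)"
  proof
    fix x assume "x \<in> E"
    then obtain w where w: "w \<in> words_in E" "x = coding_map n w"
      using assms(1) by (auto simp: sponge_eq words_in_def)
    then have "\<exists>v. v \<in> words_in E \<and> approx k v = approx k w" by blast
    from someI_ex[OF this] have "rep (approx k w) \<in> words_in E" "approx k (rep (approx k w)) = approx k w"
      by (auto simp: rep_def)
    then have "x \<in> cball (coding_map n (rep (approx k w))) r"
      using w assms(2) by (auto simp: words_in_def intro!: cylinder_dist_le)
    then show "x \<in> (\<Union>x\<in>?T. cball x r)" using w by blast
  qed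
  then have "covering_number E r \<le> card ?T"
    using fin by (intro covering_number_le) auto
  also have "\<dots> \<le> card (approx k ` words_in E)" using fin by (rule card_image_le)
  finally show ?thesis .
qed

lemma abs_pref_diff_le:
  assumes "w \<in> words" "w' \<in> words"
    and "\<bar>coding_map n w $ q - coding_map n w' $ q\<bar> \<le> real m / real (n $ q) ^ l"
  shows "\<bar>int (pref w q l) - int (pref w' q l)\<bar> \<le> int m + 1"
  using coding_map_bounds[OF assms(1), of q l] coding_map_bounds[OF assms(2), of q l] assms(3)
  by (intro grid_abs_diff_less[OF base_pos]) auto

lemma bounded_sponge: "bounded (sponge n D)"
proof -
  obtain w where w: "w \<in> words" using words_nonempty by blast
  have "sponge n D \<subseteq> cball (coding_map n w) (real CARD('d))"
    using w cylinder_dist_le[OF w, of _ "\<lambda>_. 0" "real CARD('d)"]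
    by (auto simp: sponge_eq approx_eq_iff)
  then show ?thesis by (rule bounded_subset[OF bounded_cball])
qed

text \<open>Points of a covering ball are at most \<open>2 * r\<close>, hence two cells, apart.
  Their prefixes differ by at most 3, so the ball meets at most \<open>7 = 2 * 3 + 1\<close> cells
  per coordinate.\<close>

lemma card_approx_le_covering_number:
  assumes "E \<subseteq> sponge n D" "r > 0" "\<And>q. r \<le> 1 / real (n $ q) ^ k q"
  shows "card (approx k ` words_in E) \<le> 7 ^ CARD('d) * covering_number E r"
proof -
  obtain T where T: "finite T" "card T = covering_number E r" "E \<subseteq> (\<Union>x\<in>T. cball x r)"
    using covering_number_cover[OF bounded_subset[OF bounded_sponge assms(1)] assms(2)] by metis
  have sub: "approx k ` words_in E \<subseteq> (\<Union>y\<in>T. approx k ` words_in (cball y r))"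
    using T(3) unfolding words_in_def by blast
  have "card (approx k ` words_in (cball y r)) \<le> 7 ^ CARD('d)" for y
  proof (cases "words_in (cball y r) = {}")
    case False
    then obtain v where v: "v \<in> words" "coding_map n v \<in> cball y r" by (auto simp: words_in_def)
    have "\<bar>int (pref w q (k q)) - int (pref v q (k q))\<bar> \<le> int 3" if "w \<in> words_in (cball y r)" for w q
    proof -
      have "\<bar>coding_map n w $ q - coding_map n v $ q\<bar> \<le> dist (coding_map n w) (coding_map n v)"
        using dist_vec_nth_le[of "coding_map n w" q "coding_map n v"] by (simp add: dist_real_def)
      also have "\<dots> \<le> 2 * r"
        using that v dist_triangle3[of "coding_map n w" "coding_map n v" y] by (auto simp: words_in_def)
      also have "\<dots> \<le> real 2 / real (n $ q) ^ k q" using assms(3)[of q] by simp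
      finally show ?thesis
        using abs_pref_diff_le[of w v q 2 "k q"] that v by (auto simp: words_in_def)
    qed
    then show ?thesis
      using card_approx_pref_le(2)[of "words_in (cball y r)" k "\<lambda>q. int (pref v q (k q))" 3]
      by (auto simp: words_in_def)
  qed simp
  then have "(\<Sum>y\<in>T. card (approx k ` words_in (cball y r))) \<le> card T * 7 ^ CARD('d)"
    using sum_bounded_above[of T "\<lambda>y. card (approx k ` words_in (cball y r))" "7 ^ CARD('d)"] by simp
  moreover have "card (approx k ` words_in E) \<le> card (\<Union>y\<in>T. approx k ` words_in (cball y r))"
    using T(1) by (intro card_mono sub) (auto simp: words_in_def intro!: finite_approx)
  moreover have "\<dots> \<le> (\<Sum>y\<in>T. card (approx k ` words_in (cball y r)))"
    by (rule card_UN_le[OF T(1)])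
  ultimately show ?thesis using T(2) by (simp add: mult.commute)
qed

text \<open>Points of the ball are within one cell of the centre, so prefixes differ by at most 2
  and \<open>5 = 2 * 2 + 1\<close> coarse cells per coordinate are met, each cube contributing at
  most \<open>M\<close>. With \<open>L q = 0\<close> there is one cell whatever \<open>R\<close> is,
  which admits the radii above 1 in the definition of the Assouad dimension.\<close>

lemma card_approx_ball_le:
  assumes w: "w \<in> words" and L: "\<And>q. L q = 0 \<or> R \<le> 1 / real (n $ q) ^ L q"
    and M: "\<And>v. v \<in> words \<Longrightarrow> card (approx k ` cylinder L v) \<le> M"
  shows "card (approx k ` words_in (cball (coding_map n w) R)) \<le> 5 ^ CARD('d) * M"
proof -
  let ?W = "words_in (cball (coding_map n w) R)"
  have "\<bar>int (pref v q (L q)) - int (pref w q (L q))\<bar> \<le> int 2" if "v \<in> ?W" for v q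
  proof (cases "L q = 0")
    case False
    have "\<bar>coding_map n v $ q - coding_map n w $ q\<bar> \<le> dist (coding_map n v) (coding_map n w)"
      using dist_vec_nth_le[of "coding_map n v" q "coding_map n w"] by (simp add: dist_real_def)
    also have "\<dots> \<le> R" using that by (auto simp: words_in_def dist_commute)
    also have "\<dots> \<le> real 1 / real (n $ q) ^ L q" using L[of q] False by simp
    finally show ?thesis
      using abs_pref_diff_le[of v w q 1 "L q"] that w by (auto simp: words_in_def)
  qed (simp add: pref_def)
  then have *: "finite (approx L ` ?W)" "card (approx L ` ?W) \<le> 5 ^ CARD('d)"
    using card_approx_pref_le[of ?W L "\<lambda>q. int (pref w q (L q))" 2] by (auto simp: words_in_def)
  have "card (approx k ` {y \<in> ?W. approx L y = approx L x}) \<le> M" if "x \<in> ?W" for x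
  proof -
    have "card (approx k ` {y \<in> ?W. approx L y = approx L x}) \<le> card (approx k ` cylinder L x)"
      by (intro card_mono finite_approx image_mono) (auto simp: cylinder_def words_in_def)
    also have "\<dots> \<le> M" using M that by (simp add: words_in_def)
    finally show ?thesis .
  qed
  from card_image_le_fibres[OF *(1) this] have "card (approx k ` ?W) \<le> card (approx L ` ?W) * M" by simp
  also have "\<dots> \<le> 5 ^ CARD('d) * M" using *(2) by simp
  finally show ?thesis .
qed

lemma cylinder_subset_ball:
  assumes "w \<in> words" "\<And>q. real CARD('d) / real (n $ q) ^ L q \<le> R"
  shows "cylinder L w \<subseteq> words_in (cball (coding_map n w) R)"
  using cylinder_dist_le[OF assms(1) _ _ assms(2)] by (auto simp: cylinder_def words_in_def)

text \<open>Two different consecutive digits after position \<open>L q\<close> keep a point away from the boundary of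
  its approximate cube, since neither 00 nor the two largest digits occur there.\<close>

lemma ball_subset_cylinder:
  assumes w: "w \<in> words"
    and sep: "\<And>q. (\<forall>i\<in>D. \<forall>i'\<in>D. i $ q = i' $ q) \<or>
      (w (L q) $ q \<noteq> w (Suc (L q)) $ q \<and> R < 1 / real (n $ q) ^ (L q + 2))"
  shows "words_in (cball (coding_map n w) R) \<subseteq> cylinder L w"
proof
  fix v assume "v \<in> words_in (cball (coding_map n w) R)"
  then have v: "v \<in> words" and d: "dist (coding_map n w) (coding_map n v) \<le> R"
    by (auto simp: words_in_def)
  have "pref v q (L q) = pref w q (L q)" for q
  proof (cases "\<forall>i\<in>D. \<forall>i'\<in>D. i $ q = i' $ q")
    case True
    \<comment> \<open>A coordinate in which all letters agree offers no two different digits, but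
      then no word can leave the cell in that direction.\<close>
    then have "v j $ q = w j $ q" for j using v w by (auto simp: words_def)
    then show ?thesis by (simp add: pref_def)
  next
    case False
    let ?b = "int (n $ q)" and ?l = "L q" and ?N = "real (n $ q) ^ (L q + 2)"
    define a where "a = int (w ?l $ q)"
    define c where "c = int (w (Suc ?l) $ q)"
    define A where "A = int (pref w q ?l)"
    define A' where "A' = int (pref v q ?l)"
    have "a \<noteq> c" and R: "R < 1 / ?N" using sep[of q] False by (auto simp: a_def c_def)
    have ac: "0 \<le> a" "a < ?b" "0 \<le> c" "c < ?b"
      using word_digit[OF w, of ?l q] word_digit[OF w, of "Suc ?l" q] by (auto simp: a_def c_def)
    have lo: "1 \<le> ?b * a + c"
    proof (cases "a = 0")
      case False
      then have "?b * 1 \<le> ?b * a" using ac by (intro mult_left_mono) auto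
      then show ?thesis using ac base_ge_2[of q] by linarith
    qed (use ac \<open>a \<noteq> c\<close> in auto)
    have hi: "?b * a + c + 2 \<le> ?b * ?b"
    proof (cases "a = ?b - 1")
      case True
      then have "?b * a = ?b * ?b - ?b" by (simp only: right_diff_distrib mult_1_right)
      then show ?thesis using ac \<open>a \<noteq> c\<close> True by linarith
    next
      case False
      then have "?b * a \<le> ?b * (?b - 2)" using ac by (intro mult_left_mono) auto
      then show ?thesis using ac base_ge_2[of q] by (simp add: algebra_simps)
    qed
    have pw: "int (pref w q (?l + 2)) = ?b * ?b * A + (?b * a + c)"
      by (simp add: pref_def a_def c_def A_def algebra_simps)
    have N: "?N > 0" "?N = real (n $ q) ^ ?l * (real (n $ q) * real (n $ q))"
      using base_pos[of q "L q + 2"] by (auto simp: power_add power2_eq_square)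
    \<comment> \<open>In units of cells two levels finer, \<open>lo\<close> and \<open>hi\<close>
      keep \<open>x\<close> at distance at least 1 from both ends of the coarse cell
      \<open>A\<close>, while \<open>y\<close> is at distance less than 1 from
      \<open>x\<close>.\<close>
    define x where "x = coding_map n w $ q * ?N"
    define y where "y = coding_map n v $ q * ?N"
    have x: "real_of_int (?b * ?b * A + (?b * a + c)) \<le> x" "x \<le> real_of_int (?b * ?b * A + (?b * a + c)) + 1"
      using coding_map_bounds[OF w, of q "?l + 2"] N(1) unfolding pw[symmetric] x_def
      by (simp_all add: field_simps)
    have N': "real (n $ q) ^ ?l > 0" "real (n $ q) * real (n $ q) > 0"
      using base_pos[of q ?l] base_pos[of q 1] by auto
    have "real (pref v q ?l) \<le> coding_map n v $ q * real (n $ q) ^ ?l"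
      "coding_map n v $ q * real (n $ q) ^ ?l \<le> real (pref v q ?l) + 1"
      using coding_map_bounds[OF v, of q ?l] N' by (simp_all add: field_simps)
    from mult_right_mono[OF this(1) less_imp_le[OF N'(2)]] mult_right_mono[OF this(2) less_imp_le[OF N'(2)]]
    have y: "real_of_int (?b * ?b * A') \<le> y" "y \<le> real_of_int (?b * ?b * (A' + 1))"
      unfolding y_def N(2) A'_def by (simp_all add: algebra_simps)
    have "\<bar>coding_map n w $ q - coding_map n v $ q\<bar> < 1 / ?N"
      using dist_vec_nth_le[of "coding_map n w" q "coding_map n v"] d R by (simp add: dist_real_def)
    then have "\<bar>coding_map n w $ q - coding_map n v $ q\<bar> * ?N < 1"
      using N(1) by (simp add: pos_less_divide_eq)
    then have "\<bar>x - y\<bar> < 1"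
      using N(1) by (simp add: x_def y_def abs_mult left_diff_distrib[symmetric])
    then have "real_of_int (?b * ?b * A + (?b * a + c)) < real_of_int (?b * ?b * (A' + 1) + 1)"
      "real_of_int (?b * ?b * A') < real_of_int (?b * ?b * A + (?b * a + c) + 2)"
      using x y unfolding of_int_add[of _ 1] of_int_add[of _ 2] of_int_1 of_int_numeral by linarith+
    then have "?b * ?b * A + (?b * a + c) < ?b * ?b * (A' + 1) + 1"
      "?b * ?b * A' < ?b * ?b * A + (?b * a + c) + 2"
      unfolding of_int_less_iff .
    then have "?b * ?b * A < ?b * ?b * (A' + 1)" "?b * ?b * A' < ?b * ?b * (A + 1)"
      using lo hi unfolding distrib_left[of _ _ 1] by linarith+
    then have "A < A' + 1" "A' < A + 1"
      by (simp_all add: mult_less_cancel_left)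
    then show ?thesis by (simp add: A_def A'_def)
  qed
  then show "v \<in> cylinder L w"
    using v w by (simp add: cylinder_def approx_eq_iff_pref)
qed

end

section \<open>Extremal numbers of approximate cubes\<close>

context digit_sponge
begin

lemma branch_bounds:
  assumes "i \<in> D"
  shows "1 \<le> branch S T i" "branch S T i \<le> card D"
proof -
  have "finite {i' \<in> D. trunc S i' = trunc S i}" "{i' \<in> D. trunc S i' = trunc S i} \<noteq> {}"
    using finite_D assms by auto
  then have "0 < branch S T i" unfolding branch_def card_gt_0_iff by simp
  then show "1 \<le> branch S T i" by simp
  have "branch S T i \<le> card {i' \<in> D. trunc S i' = trunc S i}"
    unfolding branch_def using finite_D by (intro card_image_le) auto
  also have "\<dots> \<le> card D" using finite_D by (intro card_mono) auto
  finally show "branch S T i \<le> card D" .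
qed

lemma branch_eq_1:
  assumes "i \<in> D" "T \<subseteq> S"
  shows "branch S T i = 1"
proof -
  have "trunc T ` {i' \<in> D. trunc S i' = trunc S i} = {trunc T i}"
    using assms by (force simp: trunc_eq_iff)
  then show ?thesis by (simp add: branch_def)
qed

definition "branch_max S T = Max (branch S T ` D)"
definition "branch_min S T = Min (branch S T ` D)"

lemma branch_le_max: "i \<in> D \<Longrightarrow> branch S T i \<le> branch_max S T"
  and branch_min_le: "i \<in> D \<Longrightarrow> branch_min S T \<le> branch S T i"
  using finite_D by (auto simp: branch_max_def branch_min_def)

lemma branch_max_witness: "\<exists>i\<in>D. branch S T i = branch_max S T"
  and branch_min_witness: "\<exists>i\<in>D. branch S T i = branch_min S T"
proof -
  have "branch_max S T \<in> branch S T ` D" "branch_min S T \<in> branch S T ` D"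
    using finite_D nonempty by (simp_all add: branch_max_def branch_min_def)
  then show "\<exists>i\<in>D. branch S T i = branch_max S T" "\<exists>i\<in>D. branch S T i = branch_min S T"
    by (metis imageE)+
qed

text \<open>What the growth estimates need of the extremal branch numbers; it holds for maxima and
  minima alike, so both spectra share one computation.\<close>

definition admissible :: "('d set \<Rightarrow> 'd set \<Rightarrow> nat) \<Rightarrow> bool" where
  "admissible H \<longleftrightarrow> (\<forall>S T. 1 \<le> H S T \<and> H S T \<le> card D \<and> (T \<subseteq> S \<longrightarrow> H S T = 1))"

lemma admissible_branch_max: "admissible branch_max"
  and admissible_branch_min: "admissible branch_min"
proof -
  show "admissible branch_max"
    unfolding admissible_def using branch_max_witness branch_bounds branch_eq_1 by metis
  show "admissible branch_min"
    unfolding admissible_def using branch_min_witness branch_bounds branch_eq_1 by metis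
qed

definition weight :: "('d set \<Rightarrow> 'd set \<Rightarrow> nat) \<Rightarrow> ('d \<Rightarrow> nat) \<Rightarrow> ('d \<Rightarrow> nat) \<Rightarrow> nat" where
  "weight H L k = (\<Prod>j<height k. H {q. j < L q} {q. j < k q})"

lemma card_approx_cylinder_bounds:
  assumes "w \<in> words"
  shows "weight branch_min L k \<le> card (approx k ` cylinder L w)"
    "card (approx k ` cylinder L w) \<le> weight branch_max L k"
  using assms unfolding card_approx_cylinder[OF assms] weight_def words_def
  by (auto intro!: prod_mono branch_le_max branch_min_le)

lemma covering_number_ball_le_weight:
  assumes "x \<in> sponge n D" "\<And>q. L q = 0 \<or> R \<le> 1 / real (n $ q) ^ L q"
    and "\<And>q. real CARD('d) / real (n $ q) ^ k q \<le> r"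
  shows "covering_number (cball x R \<inter> sponge n D) r \<le> 5 ^ CARD('d) * weight branch_max L k"
proof -
  obtain w where w: "w \<in> words" "x = coding_map n w" using assms(1) by (auto simp: sponge_eq)
  have "covering_number (cball x R \<inter> sponge n D) r \<le> card (approx k ` words_in (cball x R \<inter> sponge n D))"
    by (intro covering_number_le_card_approx assms(3)) auto
  also have "words_in (cball x R \<inter> sponge n D) = words_in (cball x R)"
    by (auto simp: words_in_def sponge_eq)
  also have "card (approx k ` words_in (cball x R)) \<le> 5 ^ CARD('d) * weight branch_max L k"
    unfolding w(2) by (rule card_approx_ball_le[OF w(1) assms(2)]) (rule card_approx_cylinder_bounds)
  finally show ?thesis .
qed

lemma card_approx_cylinder_le_covering_number:
  assumes "w \<in> words" "r > 0" "\<And>q. r \<le> 1 / real (n $ q) ^ k q"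
    and "\<And>q. real CARD('d) / real (n $ q) ^ L q \<le> R"
  shows "card (approx k ` cylinder L w) \<le>
    7 ^ CARD('d) * covering_number (cball (coding_map n w) R \<inter> sponge n D) r"
proof -
  let ?E = "cball (coding_map n w) R \<inter> sponge n D"
  have "words_in ?E = words_in (cball (coding_map n w) R)"
    by (auto simp: words_in_def sponge_eq)
  then have "cylinder L w \<subseteq> words_in ?E"
    using cylinder_subset_ball[OF assms(1,4)] by simp
  then have "card (approx k ` cylinder L w) \<le> card (approx k ` words_in ?E)"
    by (intro card_mono finite_approx image_mono) (auto simp: words_in_def)
  also have "\<dots> \<le> 7 ^ CARD('d) * covering_number ?E r"
    by (intro card_approx_le_covering_number assms) auto
  finally show ?thesis .
qed

lemma weight_le_covering_number_ball:
  assumes "x \<in> sponge n D" "r > 0" "\<And>q. r \<le> 1 / real (n $ q) ^ k q"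
    and "\<And>q. real CARD('d) / real (n $ q) ^ L q \<le> R"
  shows "weight branch_min L k \<le> 7 ^ CARD('d) * covering_number (cball x R \<inter> sponge n D) r"
proof -
  obtain w where w: "w \<in> words" "x = coding_map n w" using assms(1) by (auto simp: sponge_eq)
  show ?thesis
    using card_approx_cylinder_bounds(1)[OF w(1), of L k]
      card_approx_cylinder_le_covering_number[OF w(1) assms(2-4)] unfolding w(2) by linarith
qed

text \<open>All sequences over \<open>D\<close> are words, so a maximising letter can be taken at
  every position; the resulting word maximises all factors simultaneously.\<close>

lemma exists_ball_covering_number_ge_weight:
  assumes "r > 0" "\<And>q. r \<le> 1 / real (n $ q) ^ k q"
    and "\<And>q. real CARD('d) / real (n $ q) ^ L q \<le> R"
  shows "\<exists>x\<in>sponge n D. weight branch_max L k \<le> 7 ^ CARD('d) * covering_number (cball x R \<inter> sponge n D) r"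
proof -
  have "\<forall>j. \<exists>i. i \<in> D \<and> branch {q. j < L q} {q. j < k q} i = branch_max {q. j < L q} {q. j < k q}"
    using branch_max_witness by blast
  from choice[OF this] obtain w where
    w: "\<And>j. w j \<in> D \<and> branch {q. j < L q} {q. j < k q} (w j) = branch_max {q. j < L q} {q. j < k q}"
    by blast
  then have "w \<in> words" by (simp add: words_def)
  moreover have "card (approx k ` cylinder L w) = weight branch_max L k"
    unfolding card_approx_cylinder[OF \<open>w \<in> words\<close>] weight_def using w by simp
  ultimately show ?thesis
    using card_approx_cylinder_le_covering_number[OF _ assms, of w] by (auto simp: sponge_eq)
qed

text \<open>The digits at the positions \<open>L q\<close> and \<open>Suc (L q)\<close> are chosen such that the ball sees only one
  approximate cube; all other digits minimise the number of branches.\<close>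

lemma exists_ball_covering_number_le_weight:
  assumes sep: "\<And>p q. p \<noteq> q \<Longrightarrow> L p + 2 \<le> L q \<or> L q + 2 \<le> L p"
    and R: "\<And>q. R < 1 / real (n $ q) ^ (L q + 2)"
    and r: "\<And>q. real CARD('d) / real (n $ q) ^ k q \<le> r"
  shows "\<exists>x\<in>sponge n D. covering_number (cball x R \<inter> sponge n D) r \<le>
    weight branch_min L k * card D ^ (2 * CARD('d))"
proof -
  have "\<forall>j. \<exists>i. i \<in> D \<and> branch {q. j < L q} {q. j < k q} i = branch_min {q. j < L q} {q. j < k q}"
    using branch_min_witness by blast
  from choice[OF this] obtain m where
    m: "\<And>j. m j \<in> D \<and> branch {q. j < L q} {q. j < k q} (m j) = branch_min {q. j < L q} {q. j < k q}"
    by blast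
  have "\<exists>i i'. i \<in> D \<and> i' \<in> D \<and> ((\<forall>i\<in>D. \<forall>i'\<in>D. i $ q = i' $ q) \<or> i $ q \<noteq> i' $ q)" for q
    using nonempty by blast
  then obtain a c where ac: "\<And>q. a q \<in> D" "\<And>q. c q \<in> D"
      "\<And>q. (\<forall>i\<in>D. \<forall>i'\<in>D. i $ q = i' $ q) \<or> a q $ q \<noteq> c q $ q"
    by metis
  \<comment> \<open>The separation of the levels makes the prescribed positions of different
    coordinates disjoint, so \<open>SOME\<close> recovers the coordinate from the position.\<close>
  define w where "w j = (if j \<in> range L then a (SOME q. L q = j)
    else if j \<in> Suc ` range L then c (SOME q. Suc (L q) = j) else m j)" for j
  have L_inj: "p = q" if "L p = L q" for p q using sep[of p q] that by force
  have "(SOME p. L p = L q) = q" for q by (rule some_equality) (auto intro: L_inj)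
  then have w1: "w (L q) = a q" for q by (simp add: w_def)
  have "Suc (L q) \<notin> range L" for q
  proof
    assume "Suc (L q) \<in> range L"
    then obtain p where "L p = Suc (L q)" by force
    then show False using sep[of p q] by (cases "p = q") force+
  qed
  moreover have "(SOME p. Suc (L p) = Suc (L q)) = q" for q by (rule some_equality) (auto intro: L_inj)
  ultimately have w2: "w (Suc (L q)) = c q" for q by (simp add: w_def)
  have w: "w \<in> words" using ac m by (auto simp: words_def w_def)
  \<comment> \<open>Only at these at most \<open>2 * CARD('d)\<close> positions may a letter fail to
    minimise, and each of them costs at most a factor \<open>card D\<close>.\<close>
  define B where "B = range L \<union> Suc ` range L"
  have "finite B" by (simp add: B_def)
  have "card B \<le> card (range L) + card (range L)"
    unfolding B_def by (intro order_trans[OF card_Un_le] add_left_mono card_image_le) simp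
  also have "card (range L) \<le> CARD('d)" by (rule card_image_le) simp
  finally have cB: "card B \<le> 2 * CARD('d)" by simp
  have D1: "1 \<le> card D" using finite_D nonempty by (simp add: Suc_leI card_gt_0_iff)
  have "card (approx k ` cylinder L w) \<le>
      (\<Prod>j<height k. branch_min {q. j < L q} {q. j < k q} * (if j \<in> B then card D else 1))"
    unfolding card_approx_cylinder[OF w]
  proof (intro prod_mono conjI)
    fix j
    have 1: "1 \<le> branch_min {q. j < L q} {q. j < k q}"
      using admissible_branch_min by (auto simp: admissible_def)
    have "w j \<in> D" using w by (simp add: words_def)
    show "branch {q. j < L q} {q. j < k q} (w j) \<le> branch_min {q. j < L q} {q. j < k q} * (if j \<in> B then card D else 1)"
    proof (cases "j \<in> B")
      case True
      then show ?thesis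
        using branch_bounds(2)[OF \<open>w j \<in> D\<close>, of "{q. j < L q}" "{q. j < k q}"] mult_le_mono1[OF 1, of "card D"]
        unfolding if_P[OF True] mult_1 by linarith
    next
      case False
      then have "w j = m j" by (auto simp: B_def w_def)
      then show ?thesis using m False by simp
    qed
  qed simp
  also have "\<dots> = weight branch_min L k * (\<Prod>j<height k. if j \<in> B then card D else 1)"
    by (simp add: prod.distrib weight_def)
  also have "(\<Prod>j<height k. if j \<in> B then card D else 1) = card D ^ card ({..<height k} \<inter> B)"
    by (simp add: prod.If_cases)
  also have "\<dots> \<le> card D ^ (2 * CARD('d))"
    using card_mono[OF \<open>finite B\<close>, of "{..<height k} \<inter> B"] cB D1 by (intro power_increasing) auto
  finally have le: "card (approx k ` cylinder L w) \<le> weight branch_min L k * card D ^ (2 * CARD('d))"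
    by simp
  let ?E = "cball (coding_map n w) R \<inter> sponge n D"
  have "words_in (cball (coding_map n w) R) \<subseteq> cylinder L w"
    by (rule ball_subset_cylinder[OF w]) (use ac(3) w1 w2 R in auto)
  then have sub: "words_in ?E \<subseteq> cylinder L w" by (auto simp: words_in_def)
  have "covering_number ?E r \<le> card (approx k ` words_in ?E)"
    by (intro covering_number_le_card_approx r) auto
  also have "\<dots> \<le> card (approx k ` cylinder L w)"
    by (intro card_mono finite_approx image_mono sub) (auto simp: cylinder_def)
  also note le
  finally show ?thesis using w by (auto simp: sponge_eq)
qed

text \<open>The whole sponge is the cylinder of level 0. With no coordinate fixed, the branch number
  is the same for all letters, so its maximum is the exact factor.\<close>

lemma covering_number_sponge_bounds:
  shows "(\<And>q. real CARD('d) / real (n $ q) ^ k q \<le> r) \<Longrightarrow>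
      covering_number (sponge n D) r \<le> weight branch_max (\<lambda>_. 0) k"
    and "r > 0 \<Longrightarrow> (\<And>q. r \<le> 1 / real (n $ q) ^ k q) \<Longrightarrow>
      weight branch_max (\<lambda>_. 0) k \<le> 7 ^ CARD('d) * covering_number (sponge n D) r"
proof -
  obtain w where w: "w \<in> words" using words_nonempty by blast
  have "words_in (sponge n D) = cylinder (\<lambda>_. 0) w"
    by (auto simp: words_in_def cylinder_def sponge_eq approx_eq_iff)
  moreover have bm: "branch {} T i = branch_max {} T" if "i \<in> D" for i T
  proof -
    have "branch {} T ` D = {branch {} T i}"
      using that by (auto simp: branch_def trunc_eq_iff)
    then show ?thesis by (simp add: branch_max_def)
  qed
  have "card (approx k ` cylinder (\<lambda>_. 0) w) = weight branch_max (\<lambda>_. 0) k"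
    unfolding card_approx_cylinder[OF w] weight_def using w by (intro prod.cong) (simp_all add: words_def bm)
  ultimately have eq: "card (approx k ` words_in (sponge n D)) = weight branch_max (\<lambda>_. 0) k" by simp
  show "covering_number (sponge n D) r \<le> weight branch_max (\<lambda>_. 0) k"
    if "\<And>q. real CARD('d) / real (n $ q) ^ k q \<le> r"
    using covering_number_le_card_approx[OF order_refl that] eq by simp
  show "weight branch_max (\<lambda>_. 0) k \<le> 7 ^ CARD('d) * covering_number (sponge n D) r"
    if "r > 0" "\<And>q. r \<le> 1 / real (n $ q) ^ k q"
    using card_approx_le_covering_number[OF order_refl that] eq by simp
qed

end

section \<open>Exponential growth of the extremal numbers\<close>

lemma prod_if_interval:
  assumes "hi \<le> (h::nat)"
  shows "(\<Prod>j<h. if lo \<le> j \<and> j < hi then c else 1) = (c::nat) ^ (hi - lo)"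
proof -
  have "{..<h} \<inter> {j. lo \<le> j \<and> j < hi} = {lo..<hi}" using assms by auto
  then show ?thesis by (simp add: prod.If_cases)
qed

text \<open>Truncated subtraction of naturals is the positive part of the real difference, which
  explains the \<open>max 0\<close> in the real-valued counterpart.\<close>

lemma abs_gap_diff_le:
  fixes hi lo :: nat and hi' lo' K c \<delta> :: real
  assumes "\<bar>real hi - hi'\<bar> \<le> K" "\<bar>real lo - lo'\<bar> \<le> K" "0 \<le> c" "c \<le> \<delta>"
  shows "\<bar>c * real (hi - lo) - c * max 0 (hi' - lo')\<bar> \<le> 2 * K * \<delta>"
proof -
  have "real (hi - lo) = max 0 (real hi - real lo)" by (simp add: max_def of_nat_diff)
  then have "\<bar>real (hi - lo) - max 0 (hi' - lo')\<bar> \<le> 2 * K" using assms(1,2) by linarith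
  then have "c * \<bar>real (hi - lo) - max 0 (hi' - lo')\<bar> \<le> \<delta> * (2 * K)"
    using assms by (intro mult_mono) auto
  then show ?thesis
    using assms(3) by (simp add: right_diff_distrib[symmetric] abs_mult mult.commute mult.left_commute)
qed

lemma abs_sum6_diff_le:
  fixes B :: real
  assumes "\<bar>x1 - y1\<bar> \<le> B" "\<bar>x2 - y2\<bar> \<le> B" "\<bar>x3 - y3\<bar> \<le> B"
    "\<bar>x4 - y4\<bar> \<le> B" "\<bar>x5 - y5\<bar> \<le> B" "\<bar>x6 - y6\<bar> \<le> B"
  shows "\<bar>(x1 + x2 + x3 + x4 + x5 + x6) - (y1 + y2 + y3 + y4 + y5 + y6)\<bar> \<le> 6 * B"
  using assms by linarith

lemma floor_level:
  fixes b :: nat and x :: real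
  assumes "2 \<le> b" "0 \<le> x"
  shows "\<bar>real (nat \<lfloor>x / ln b\<rfloor>) - x / ln b\<bar> \<le> 1"
    "exp (- x) \<le> 1 / real b ^ nat \<lfloor>x / ln b\<rfloor>"
proof -
  define l where "l = nat \<lfloor>x / ln b\<rfloor>"
  have b: "ln (real b) > 0" using assms by simp
  then have "0 \<le> x / ln b" using assms by simp
  then have l: "real l \<le> x / ln b" "x / ln b < real l + 1"
    unfolding l_def by linarith+
  then show "\<bar>real (nat \<lfloor>x / ln b\<rfloor>) - x / ln b\<bar> \<le> 1" unfolding l_def by linarith
  have p: "real b ^ m = exp (real m * ln b)" for m
    using assms by (simp add: exp_of_nat_mult)
  have "real l * ln b \<le> x" using l b by (simp add: field_simps)
  then show "exp (- x) \<le> 1 / real b ^ nat \<lfloor>x / ln b\<rfloor>"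
    unfolding p l_def[symmetric] by (simp only: exp_minus inverse_eq_divide[symmetric] inverse_le_iff_le exp_gt_zero exp_le_cancel_iff)
qed

text \<open>\<open>c\<close> will be the factor \<open>CARD(3)\<close> from the norm estimate. As
  \<open>c \<le> 4\<close> and \<open>b \<ge> 2\<close>, it shifts the level by at most 2, and
  rounding by at most 1.\<close>

lemma ceiling_level:
  fixes b :: nat and x c :: real
  assumes "2 \<le> b" "0 \<le> x" "1 \<le> c" "c \<le> 4"
  shows "\<bar>real (nat \<lceil>(x + ln c) / ln b\<rceil>) - x / ln b\<bar> \<le> 3"
    "c / real b ^ nat \<lceil>(x + ln c) / ln b\<rceil> \<le> exp (- x)"
proof -
  define l where "l = nat \<lceil>(x + ln c) / ln b\<rceil>"
  have b: "ln (real b) > 0" using assms by simp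
  have c: "0 \<le> ln c" using assms by simp
  have "ln c \<le> ln (2 ^ 2)" using assms by (intro ln_mono) auto
  also have "\<dots> = 2 * ln 2" by (subst ln_realpow) auto
  also have "\<dots> \<le> 2 * ln (real b)" using assms by simp
  finally have "ln c / ln b \<le> 2" using b by (simp add: field_simps)
  moreover have "0 \<le> (x + ln c) / ln b" "0 \<le> ln c / ln b" using assms b c by simp_all
  then have l: "(x + ln c) / ln b \<le> real l" "real l < (x + ln c) / ln b + 1"
    unfolding l_def by linarith+
  moreover have "(x + ln c) / ln b = x / ln b + ln c / ln b" by (rule add_divide_distrib)
  ultimately show "\<bar>real (nat \<lceil>(x + ln c) / ln b\<rceil>) - x / ln b\<bar> \<le> 3"
    using \<open>0 \<le> ln c / ln b\<close> unfolding l_def by linarith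
  have p: "real b ^ l = exp (real l * ln b)"
    using assms by (simp add: exp_of_nat_mult)
  have "x + ln c \<le> real l * ln b" using l(1) b by (simp add: field_simps)
  then have "ln c - real l * ln b \<le> - x" by linarith
  then have "exp (ln c - real l * ln b) \<le> exp (- x)" by simp
  then show "c / real b ^ nat \<lceil>(x + ln c) / ln b\<rceil> \<le> exp (- x)"
    unfolding l_def[symmetric] p using assms by (simp add: exp_diff)
qed

locale digit_sponge3 = digit_sponge n D for n :: "nat ^ 3" and D +
  assumes base_less: "n $ 1 < n $ 2" "n $ 2 < n $ 3"
begin

lemma ln_base: "0 < ln (real (n $ 1))" "ln (real (n $ 1)) < ln (real (n $ 2))"
    "ln (real (n $ 2)) < ln (real (n $ 3))" "0 < ln (real (n $ q))"
  using base_less base_ge_2[of 1] base_ge_2[of q] by auto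

lemma ln_base_divide_mono:
  assumes "0 \<le> x"
  shows "x / ln (real (n $ 3)) \<le> x / ln (real (n $ 2))" "x / ln (real (n $ 2)) \<le> x / ln (real (n $ 1))"
  using assms ln_base by (auto intro!: divide_left_mono mult_pos_pos)

text \<open>Since the levels are ordered, the coordinates fixed or resolved at a position form one
  of \<open>{}\<close>, \<open>{1}\<close>, \<open>{1, 2}\<close>, \<open>UNIV\<close>. A pair with
  \<open>T \<subseteq> S\<close> contributes 1; each of the six remaining pairs occurs on an
  interval of positions.\<close>

lemma weight_eq:
  assumes H: "admissible H" and L: "L 3 \<le> L 2" "L 2 \<le> L 1" and k: "k 3 \<le> k 2" "k 2 \<le> k 1"
  shows "weight H L k =
    H {1, 2} UNIV ^ (min (L 2) (k 3) - L 3) * H {1} UNIV ^ (min (L 1) (k 3) - L 2) * H {} UNIV ^ (k 3 - L 1) *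
    H {1} {1, 2} ^ (min (L 1) (k 2) - max (L 2) (k 3)) * H {} {1, 2} ^ (k 2 - max (L 1) (k 3)) *
    H {} {1} ^ (k 1 - max (L 1) (k 2))"
proof -
  define I where "I lo hi c j = (if lo \<le> j \<and> j < hi then c else 1)" for lo hi c j :: nat
  have lvl: "{q. j < f q} = (if j < f 3 then UNIV else if j < f 2 then {1, 2} else if j < f 1 then {1} else {})"
    if "f 3 \<le> f 2" "f 2 \<le> f 1" for j :: nat and f :: "3 \<Rightarrow> nat"
    using that by (auto simp: set_eq_iff forall_3)
  have H1: "H UNIV T = 1" "H S {} = 1" "H S S = 1" "H {1, 2} {1} = 1" for S T
    using H by (auto simp: admissible_def)
  have h: "k q \<le> height k" for q by (rule le_height)
  \<comment> \<open>The six intervals are disjoint, so at each position at most one of the factors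
    \<open>I\<close> differs from 1.\<close>
  have "H {q. j < L q} {q. j < k q} =
      I (L 3) (min (L 2) (k 3)) (H {1, 2} UNIV) j * I (L 2) (min (L 1) (k 3)) (H {1} UNIV) j *
      I (L 1) (k 3) (H {} UNIV) j * I (max (L 2) (k 3)) (min (L 1) (k 2)) (H {1} {1, 2}) j *
      I (max (L 1) (k 3)) (k 2) (H {} {1, 2}) j * I (max (L 1) (k 2)) (k 1) (H {} {1}) j" for j
    unfolding lvl[OF L] lvl[OF k] I_def using L k by (auto simp: H1)
  then show ?thesis
    unfolding weight_def I_def prod.distrib
    by (simp only: prod.distrib prod_if_interval h min.coboundedI2)
qed

text \<open>The levels at scale \<open>exp (- x)\<close> are \<open>x / ln (n $ q)\<close> up to bounded errors. Every term belongs to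
  one range of positions of the words, with certain coordinates fixed at the coarse scale \<open>exp (- x)\<close>
  and certain coordinates resolved at the fine scale \<open>exp (- y)\<close>.\<close>

definition entropy :: "(3 set \<Rightarrow> 3 set \<Rightarrow> nat) \<Rightarrow> real \<Rightarrow> real \<Rightarrow> real" where
  "entropy H x y =
    ln (H {1, 2} UNIV) * max 0 (min (x / ln (n $ 2)) (y / ln (n $ 3)) - x / ln (n $ 3)) +
    ln (H {1} UNIV) * max 0 (min (x / ln (n $ 1)) (y / ln (n $ 3)) - x / ln (n $ 2)) +
    ln (H {} UNIV) * max 0 (y / ln (n $ 3) - x / ln (n $ 1)) +
    ln (H {1} {1, 2}) * max 0 (min (x / ln (n $ 1)) (y / ln (n $ 2)) - max (x / ln (n $ 2)) (y / ln (n $ 3))) +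
    ln (H {} {1, 2}) * max 0 (y / ln (n $ 2) - max (x / ln (n $ 1)) (y / ln (n $ 3))) +
    ln (H {} {1}) * max 0 (y / ln (n $ 1) - max (x / ln (n $ 1)) (y / ln (n $ 2)))"

lemma ln_admissible:
  assumes "admissible H"
  shows "0 \<le> ln (real (H S T))" "ln (real (H S T)) \<le> ln (real (card D))"
proof -
  have "1 \<le> H S T" "H S T \<le> card D" using assms by (auto simp: admissible_def)
  then show "0 \<le> ln (real (H S T))" "ln (real (H S T)) \<le> ln (real (card D))" by auto
qed

lemma entropy_nonneg:
  assumes "admissible H"
  shows "0 \<le> entropy H x y"
  unfolding entropy_def using ln_admissible[OF assms] by (intro add_nonneg_nonneg mult_nonneg_nonneg) auto

text \<open>Homogeneity is the reason why the spectra depend on the ratio of the logarithmic scales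
  alone.\<close>

lemma entropy_scale:
  assumes "0 \<le> t"
  shows "entropy H (t * x) (t * y) = t * entropy H x y"
proof -
  have "min (t * a) (t * b) = t * min a b" "max (t * a) (t * b) = t * max a b" "max 0 (t * a) = t * max 0 a"
    for a b :: real
    using assms max_mult_distrib_left[of t 0 a] by (simp_all add: min_mult_distrib_left max_mult_distrib_left)
  then show ?thesis
    unfolding entropy_def times_divide_eq_right[symmetric]
    by (simp only: right_diff_distrib[symmetric] distrib_left mult.left_commute)
qed

lemma ln_weight_entropy:
  assumes H: "admissible H" and L: "L 3 \<le> L 2" "L 2 \<le> L 1" and k: "k 3 \<le> k 2" "k 2 \<le> k 1"
    and Lx: "\<And>q. \<bar>real (L q) - x / ln (n $ q)\<bar> \<le> K" and ky: "\<And>q. \<bar>real (k q) - y / ln (n $ q)\<bar> \<le> K"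
  shows "\<bar>ln (weight H L k) - entropy H x y\<bar> \<le> 6 * (2 * K * ln (card D))"
proof -
  have "0 < real (H S T)" for S T using H by (force simp: admissible_def intro: Suc_le_lessD)
  then have eq: "ln (weight H L k) =
    ln (H {1, 2} UNIV) * real (min (L 2) (k 3) - L 3) + ln (H {1} UNIV) * real (min (L 1) (k 3) - L 2) +
    ln (H {} UNIV) * real (k 3 - L 1) +
    ln (H {1} {1, 2}) * real (min (L 1) (k 2) - max (L 2) (k 3)) + ln (H {} {1, 2}) * real (k 2 - max (L 1) (k 3)) +
    ln (H {} {1}) * real (k 1 - max (L 1) (k 2))"
    unfolding weight_eq[OF H L k] of_nat_mult of_nat_power
    by (simp only: ln_mult_pos mult_pos_pos zero_less_power ln_realpow mult.commute)
  have mm: "\<bar>real (min a b) - min a' b'\<bar> \<le> K" "\<bar>real (max a b) - max a' b'\<bar> \<le> K"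
    if "\<bar>real a - a'\<bar> \<le> K" "\<bar>real b - b'\<bar> \<le> K" for a b :: nat and a' b' :: real
    using that unfolding of_nat_min of_nat_max by linarith+
  note gap = abs_gap_diff_le[OF _ _ ln_admissible[OF H]]
  show ?thesis
    unfolding eq entropy_def
    by (intro abs_sum6_diff_le gap mm Lx ky)
qed

text \<open>\<open>48 = 6 * 2 * 4\<close>: six ranges, two ends each, and levels known up to 4. The
  error 4 covers both roundings and the levels lowered by 3 that keep a ball inside its
  cube.\<close>

definition distortion :: real where "distortion = exp (48 * ln (card D))"

lemma weight_entropy_bounds:
  assumes H: "admissible H" and L: "L 3 \<le> L 2" "L 2 \<le> L 1" and k: "k 3 \<le> k 2" "k 2 \<le> k 1"
    and Lx: "\<And>q. \<bar>real (L q) - x / ln (n $ q)\<bar> \<le> 4" and ky: "\<And>q. \<bar>real (k q) - y / ln (n $ q)\<bar> \<le> 4"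
  shows "real (weight H L k) \<le> distortion * exp (entropy H x y)"
    "exp (entropy H x y) \<le> distortion * real (weight H L k)"
proof -
  have "0 < weight H L k"
    unfolding weight_def using H by (intro prod_pos) (auto simp: admissible_def intro: Suc_le_lessD)
  then have w: "real (weight H L k) = exp (ln (weight H L k))" by simp
  have *: "\<bar>ln (weight H L k) - entropy H x y\<bar> \<le> 48 * ln (card D)"
    using ln_weight_entropy[OF assms] by simp
  have "ln (weight H L k) \<le> 48 * ln (card D) + entropy H x y" "entropy H x y \<le> 48 * ln (card D) + ln (weight H L k)"
    using * by linarith+
  then have "exp (ln (weight H L k)) \<le> exp (48 * ln (card D) + entropy H x y)"
    "exp (entropy H x y) \<le> exp (48 * ln (card D) + ln (weight H L k))"
    by (simp_all only: exp_le_cancel_iff)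
  then show "real (weight H L k) \<le> distortion * exp (entropy H x y)"
    "exp (entropy H x y) \<le> distortion * real (weight H L k)"
    unfolding exp_add w[symmetric] distortion_def .
qed

lemma distortion_pos: "0 < distortion"
  by (simp add: distortion_def)

text \<open>Rounding down gives cells of side at least \<open>exp (- x)\<close>; rounding up, with
  \<open>ln 3\<close> added, gives cubes of diameter at most \<open>exp (- x)\<close>. Each estimate
  needs one kind at the coarse scale and one at the fine scale.\<close>

definition "lower_level x q = nat \<lfloor>x / ln (n $ q)\<rfloor>"
definition "upper_level x q = nat \<lceil>(x + ln 3) / ln (n $ q)\<rceil>"

lemma lower_level:
  assumes "0 \<le> x"
  shows "lower_level x 3 \<le> lower_level x 2" "lower_level x 2 \<le> lower_level x 1"
    "\<bar>real (lower_level x q) - x / ln (n $ q)\<bar> \<le> 4" "exp (- x) \<le> 1 / real (n $ q) ^ lower_level x q"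
proof -
  show "lower_level x 3 \<le> lower_level x 2" "lower_level x 2 \<le> lower_level x 1"
    unfolding lower_level_def by (intro nat_mono floor_mono ln_base_divide_mono assms)+
  show "\<bar>real (lower_level x q) - x / ln (n $ q)\<bar> \<le> 4" "exp (- x) \<le> 1 / real (n $ q) ^ lower_level x q"
    using floor_level[OF base_ge_2 assms, of q] by (simp_all add: lower_level_def)
qed

lemma upper_level:
  assumes "0 \<le> x"
  shows "upper_level x 3 \<le> upper_level x 2" "upper_level x 2 \<le> upper_level x 1"
    "\<bar>real (upper_level x q) - x / ln (n $ q)\<bar> \<le> 4" "real CARD(3) / real (n $ q) ^ upper_level x q \<le> exp (- x)"
proof -
  have "0 \<le> x + ln 3" using assms by simp
  then show "upper_level x 3 \<le> upper_level x 2" "upper_level x 2 \<le> upper_level x 1"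
    unfolding upper_level_def by (intro nat_mono ceiling_mono ln_base_divide_mono; assumption)+
  show "\<bar>real (upper_level x q) - x / ln (n $ q)\<bar> \<le> 4" "real CARD(3) / real (n $ q) ^ upper_level x q \<le> exp (- x)"
    using ceiling_level[OF base_ge_2 assms, of 3 q] by (simp_all add: upper_level_def)
qed

text \<open>Coarse levels are rounded down so that the ball meets few cubes, fine levels up so that
  each cube fits into a ball; \<open>125 = 5 ^ 3\<close>. Clamping at 0 covers scales above
  1.\<close>

lemma covering_number_ball_le:
  assumes "x \<in> sponge n D" "0 < r" "0 < R"
  shows "real (covering_number (cball x R \<inter> sponge n D) r) \<le>
    125 * distortion * exp (entropy branch_max (max 0 (ln (1 / R))) (max 0 (ln (1 / r))))"
proof -
  let ?X = "max 0 (ln (1 / R))" and ?Y = "max 0 (ln (1 / r))"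
  have "covering_number (cball x R \<inter> sponge n D) r \<le>
      5 ^ CARD(3) * weight branch_max (lower_level ?X) (upper_level ?Y)"
  proof (rule covering_number_ball_le_weight[OF assms(1)])
    fix q
    show "lower_level ?X q = 0 \<or> R \<le> 1 / real (n $ q) ^ lower_level ?X q"
    proof (cases "R \<le> 1")
      case True
      then have "R = exp (- ?X)" using assms(3) by (simp add: ln_div)
      then show ?thesis using lower_level(4)[of ?X q] by simp
    next
      case False
      then have "?X = 0" using assms(3) by (simp add: ln_div)
      then show ?thesis by (simp add: lower_level_def)
    qed
    have "real CARD(3) / real (n $ q) ^ upper_level ?Y q \<le> exp (- ?Y)" by (rule upper_level) simp
    also have "- ?Y \<le> ln r" using assms(2) by (simp add: ln_div)
    then have "exp (- ?Y) \<le> exp (ln r)" by simp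
    finally show "real CARD(3) / real (n $ q) ^ upper_level ?Y q \<le> r" using assms(2) by simp
  qed
  then have "real (covering_number (cball x R \<inter> sponge n D) r) \<le>
      real (5 ^ CARD(3) * weight branch_max (lower_level ?X) (upper_level ?Y))"
    by (simp only: of_nat_le_iff)
  also have "\<dots> = 125 * real (weight branch_max (lower_level ?X) (upper_level ?Y))" by simp
  also have "\<dots> \<le> 125 * (distortion * exp (entropy branch_max ?X ?Y))"
    by (intro mult_left_mono weight_entropy_bounds admissible_branch_max lower_level upper_level) auto
  finally show ?thesis by simp
qed

lemma level_exp:
  assumes "0 < R" "R < (1::real)"
  shows "0 \<le> ln (1 / R)" "exp (- ln (1 / R)) = R"
  using assms by (simp_all add: ln_div)

text \<open>The roundings are opposite to those of the upper bound: a coarse cube must fit into the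
  ball of radius \<open>R\<close>, and a ball of radius \<open>r\<close> must meet few fine cubes;
  \<open>343 = 7 ^ 3\<close>.\<close>

lemma entropy_le_covering_number_ball:
  assumes "x \<in> sponge n D" "0 < r" "r < 1" "0 < R" "R < 1"
  shows "exp (entropy branch_min (ln (1 / R)) (ln (1 / r))) \<le>
    343 * distortion * real (covering_number (cball x R \<inter> sponge n D) r)"
proof -
  let ?X = "ln (1 / R)" and ?Y = "ln (1 / r)"
  have "weight branch_min (upper_level ?X) (lower_level ?Y) \<le>
      7 ^ CARD(3) * covering_number (cball x R \<inter> sponge n D) r"
    using assms lower_level(4)[OF level_exp(1)[OF assms(2,3)]] upper_level(4)[OF level_exp(1)[OF assms(4,5)]]
    by (intro weight_le_covering_number_ball) (simp_all only: level_exp)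
  then have "real (weight branch_min (upper_level ?X) (lower_level ?Y)) \<le>
      real (7 ^ CARD(3) * covering_number (cball x R \<inter> sponge n D) r)"
    by (simp only: of_nat_le_iff)
  then have le: "real (weight branch_min (upper_level ?X) (lower_level ?Y)) \<le>
      343 * real (covering_number (cball x R \<inter> sponge n D) r)" by simp
  have "exp (entropy branch_min ?X ?Y) \<le> distortion * real (weight branch_min (upper_level ?X) (lower_level ?Y))"
    by (intro weight_entropy_bounds admissible_branch_min lower_level upper_level level_exp assms)
  also have "\<dots> \<le> distortion * (343 * real (covering_number (cball x R \<inter> sponge n D) r))"
    using le distortion_pos by (intro mult_left_mono) auto
  finally show ?thesis by simp
qed

lemma exists_ball_entropy_le_covering_number:
  assumes "0 < r" "r < 1" "0 < R" "R < 1"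
  shows "\<exists>x\<in>sponge n D. exp (entropy branch_max (ln (1 / R)) (ln (1 / r))) \<le>
    343 * distortion * real (covering_number (cball x R \<inter> sponge n D) r)"
proof -
  let ?X = "ln (1 / R)" and ?Y = "ln (1 / r)"
  have "\<exists>x\<in>sponge n D. weight branch_max (upper_level ?X) (lower_level ?Y) \<le>
      7 ^ CARD(3) * covering_number (cball x R \<inter> sponge n D) r"
    using assms lower_level(4)[OF level_exp(1)[OF assms(1,2)]] upper_level(4)[OF level_exp(1)[OF assms(3,4)]]
    by (intro exists_ball_covering_number_ge_weight) (simp_all only: level_exp)
  then obtain x where x: "x \<in> sponge n D" "weight branch_max (upper_level ?X) (lower_level ?Y) \<le>
      7 ^ CARD(3) * covering_number (cball x R \<inter> sponge n D) r" by blast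
  from x(2) have "real (weight branch_max (upper_level ?X) (lower_level ?Y)) \<le>
      real (7 ^ CARD(3) * covering_number (cball x R \<inter> sponge n D) r)"
    by (simp only: of_nat_le_iff)
  then have le: "real (weight branch_max (upper_level ?X) (lower_level ?Y)) \<le>
      343 * real (covering_number (cball x R \<inter> sponge n D) r)" by simp
  have "exp (entropy branch_max ?X ?Y) \<le> distortion * real (weight branch_max (upper_level ?X) (lower_level ?Y))"
    by (intro weight_entropy_bounds admissible_branch_max lower_level upper_level level_exp assms)
  also have "\<dots> \<le> distortion * (343 * real (covering_number (cball x R \<inter> sponge n D) r))"
    using le distortion_pos by (intro mult_left_mono) auto
  finally show ?thesis using x(1) by (auto intro!: bexI[of _ x])
qed

text \<open>The coarse levels of different coordinates grow at different rates in
  \<open>ln (1 / R)\<close>, so they are separated as required once \<open>R\<close> is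
  small.\<close>

lemma exists_ball_covering_number_le_entropy:
  obtains R0 where "0 < R0" "\<And>r R. 0 < r \<Longrightarrow> r < 1 \<Longrightarrow> 0 < R \<Longrightarrow> R < R0 \<Longrightarrow> R < 1 \<Longrightarrow>
    \<exists>x\<in>sponge n D. real (covering_number (cball x R \<inter> sponge n D) r) \<le>
      real (card D) ^ 6 * distortion * exp (entropy branch_min (ln (1 / R)) (ln (1 / r)))"
proof -
  define a where "a q = 1 / ln (real (n $ q))" for q
  have a: "a 3 < a 2" "a 2 < a 1" "0 < a 3"
    unfolding a_def using ln_base by (auto intro!: divide_strict_left_mono)
  \<comment> \<open>The sum of the three thresholds beyond which the levels are at least 4 and
    consecutive ones at least 3 apart.\<close>
  define X0 where "X0 = 4 / a 3 + 3 / (a 2 - a 3) + 3 / (a 1 - a 2)"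
  have large: "4 \<le> x * a 3" "x * a 3 + 3 \<le> x * a 2" "x * a 2 + 3 \<le> x * a 1" if "X0 \<le> x" for x
  proof -
    have "0 \<le> 4 / a 3" "0 \<le> 3 / (a 2 - a 3)" "0 \<le> 3 / (a 1 - a 2)" using a by auto
    then have "4 / a 3 \<le> x" "3 / (a 2 - a 3) \<le> x" "3 / (a 1 - a 2) \<le> x"
      using that unfolding X0_def by linarith+
    then show "4 \<le> x * a 3" "x * a 3 + 3 \<le> x * a 2" "x * a 2 + 3 \<le> x * a 1"
      using a by (simp_all add: pos_divide_le_eq right_diff_distrib)
  qed
  show thesis
  proof (rule that[of "exp (- X0)"])
    fix r R :: real assume r: "0 < r" "r < 1" and R: "0 < R" "R < exp (- X0)" "R < 1"
    let ?X = "ln (1 / R)" and ?Y = "ln (1 / r)"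
    have "exp (- ?X) < exp (- X0)" using R level_exp(2)[of R] by simp
    then have X: "X0 \<le> ?X" by simp
    \<comment> \<open>Subtracting 3 puts \<open>L q + 2\<close> strictly below the rounded level,
      which yields the strict inequality on \<open>R\<close>; levels of at least 4 keep the
      subtraction from being truncated.\<close>
    define L where "L q = nat \<lfloor>?X * a q\<rfloor> - 3" for q
    have fl: "lower_level ?X q = nat \<lfloor>?X * a q\<rfloor>" for q
      by (simp add: lower_level_def a_def)
    have ge: "4 \<le> ?X * a q" for q
      using large[OF X] exhaust_3[of q] by auto
    have L: "real (L q) + 3 \<le> ?X * a q" "?X * a q < real (L q) + 4" for q
      using ge[of q] unfolding L_def by linarith+
    have L21: "L 2 + 2 \<le> L 1" "L 3 + 2 \<le> L 2"
      using L[of 1] L[of 2] L[of 3] large[OF X] by linarith+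
    have "\<exists>x\<in>sponge n D. covering_number (cball x R \<inter> sponge n D) r \<le>
      weight branch_min L (upper_level ?Y) * card D ^ (2 * CARD(3))"
    proof (rule exists_ball_covering_number_le_weight)
      show "L p + 2 \<le> L q \<or> L q + 2 \<le> L p" if "p \<noteq> q" for p q
        using that L21 exhaust_3[of p] exhaust_3[of q] by auto
      show "real CARD(3) / real (n $ q) ^ upper_level ?Y q \<le> r" for q
        using upper_level(4)[OF level_exp(1)[OF r], of q] by (simp only: level_exp[OF r])
      show "R < 1 / real (n $ q) ^ (L q + 2)" for q
      proof -
        have "R \<le> 1 / real (n $ q) ^ lower_level ?X q"
          using lower_level(4)[OF level_exp(1)[OF R(1,3)], of q] by (simp only: level_exp[OF R(1,3)])
        also have "L q + 2 < lower_level ?X q" using ge[of q] unfolding fl L_def by linarith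
        then have "1 / real (n $ q) ^ lower_level ?X q < 1 / real (n $ q) ^ (L q + 2)"
          using base_ge_2[of q] by (intro divide_strict_left_mono power_strict_increasing) auto
        finally show ?thesis .
      qed
    qed
    then obtain x where x: "x \<in> sponge n D" "covering_number (cball x R \<inter> sponge n D) r \<le>
      weight branch_min L (upper_level ?Y) * card D ^ (2 * CARD(3))" by blast
    from x(2) have "real (covering_number (cball x R \<inter> sponge n D) r) \<le>
        real (weight branch_min L (upper_level ?Y) * card D ^ (2 * CARD(3)))"
      by (simp only: of_nat_le_iff)
    also have "\<dots> = real (card D) ^ 6 * real (weight branch_min L (upper_level ?Y))" by simp
    also have "\<dots> \<le> real (card D) ^ 6 * (distortion * exp (entropy branch_min ?X ?Y))"
    proof (intro mult_left_mono weight_entropy_bounds admissible_branch_min upper_level level_exp r)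
      show "\<bar>real (L q) - ?X / ln (real (n $ q))\<bar> \<le> 4" for q
        using L[of q] by (simp add: a_def)
    qed (use L21 in auto)
    finally show "\<exists>x\<in>sponge n D. real (covering_number (cball x R \<inter> sponge n D) r) \<le>
      real (card D) ^ 6 * distortion * exp (entropy branch_min ?X ?Y)"
      using x(1) by (auto simp: mult.assoc)
  qed simp
qed

lemma covering_number_sponge_entropy:
  assumes "0 < r" "r < 1"
  shows "real (covering_number (sponge n D) r) \<le> distortion * exp (entropy branch_max 0 (ln (1 / r)))"
    "exp (entropy branch_max 0 (ln (1 / r))) \<le> 343 * distortion * real (covering_number (sponge n D) r)"
proof -
  let ?Y = "ln (1 / r)"
  have "real (covering_number (sponge n D) r) \<le> real (weight branch_max (\<lambda>_. 0) (upper_level ?Y))"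
    unfolding of_nat_le_iff using upper_level(4)[OF level_exp(1)[OF assms]]
    by (intro covering_number_sponge_bounds(1)) (simp only: level_exp[OF assms])
  also have "\<dots> \<le> distortion * exp (entropy branch_max 0 ?Y)"
    by (intro weight_entropy_bounds admissible_branch_max upper_level level_exp assms) auto
  finally show "real (covering_number (sponge n D) r) \<le> distortion * exp (entropy branch_max 0 ?Y)" .
  have "weight branch_max (\<lambda>_. 0) (lower_level ?Y) \<le> 7 ^ CARD(3) * covering_number (sponge n D) r"
    using assms lower_level(4)[OF level_exp(1)[OF assms]]
    by (intro covering_number_sponge_bounds(2)) (simp_all only: level_exp[OF assms])
  then have "real (weight branch_max (\<lambda>_. 0) (lower_level ?Y)) \<le> real (7 ^ CARD(3) * covering_number (sponge n D) r)"
    by (simp only: of_nat_le_iff)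
  then have le: "real (weight branch_max (\<lambda>_. 0) (lower_level ?Y)) \<le> 343 * real (covering_number (sponge n D) r)"
    by simp
  have "exp (entropy branch_max 0 ?Y) \<le> distortion * real (weight branch_max (\<lambda>_. 0) (lower_level ?Y))"
    by (intro weight_entropy_bounds admissible_branch_max lower_level level_exp assms) auto
  also have "\<dots> \<le> distortion * (343 * real (covering_number (sponge n D) r))"
    using le distortion_pos by (intro mult_left_mono) auto
  finally show "exp (entropy branch_max 0 ?Y) \<le> 343 * distortion * real (covering_number (sponge n D) r)" by simp
qed

section \<open>The spectra in terms of the entropy\<close>

text \<open>For \<open>r = R powr (1 / \<theta>)\<close> the denominator is
  \<open>ln (R / r) / ln (1 / R)\<close>, so this is the entropy per unit of
  \<open>ln (R / r)\<close>.\<close>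

definition rate :: "(3 set \<Rightarrow> 3 set \<Rightarrow> nat) \<Rightarrow> real \<Rightarrow> real" where
  "rate H \<theta> = entropy H 1 (1 / \<theta>) / (1 / \<theta> - 1)"

lemma rate_nonneg: "admissible H \<Longrightarrow> 0 < \<theta> \<Longrightarrow> \<theta> < 1 \<Longrightarrow> 0 \<le> rate H \<theta>"
  unfolding rate_def by (intro divide_nonneg_nonneg entropy_nonneg) (auto simp: field_simps)

lemma exp_entropy_eq:
  assumes \<theta>: "0 < \<theta>" "\<theta> < 1" and R: "0 < R" "R < 1"
  shows "exp (entropy H (ln (1 / R)) (ln (1 / R powr (1 / \<theta>)))) = (R / R powr (1 / \<theta>)) powr rate H \<theta>"
proof -
  have "ln (1 / R powr (1 / \<theta>)) = ln (1 / R) * (1 / \<theta>)"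
    using R by (simp add: ln_div ln_powr)
  then have "entropy H (ln (1 / R)) (ln (1 / R powr (1 / \<theta>))) = ln (1 / R) * entropy H 1 (1 / \<theta>)"
    using entropy_scale[OF level_exp(1)[OF R], of H 1 "1 / \<theta>"] by simp
  also have "\<dots> = rate H \<theta> * ((1 - 1 / \<theta>) * ln R)"
    using \<theta> R by (simp add: rate_def ln_div divide_simps) (simp add: algebra_simps)
  finally show ?thesis
    unfolding ratio_powr_scale(1)[OF \<theta> R] using R by (simp add: powr_def)
qed

lemma covering_number_ball_le_rate:
  assumes \<theta>: "0 < \<theta>" "\<theta> < 1" and R: "0 < R" "R < 1" and x: "x \<in> sponge n D"
  shows "real (covering_number (cball x R \<inter> sponge n D) (R powr (1 / \<theta>))) \<le>
    125 * distortion * (R / R powr (1 / \<theta>)) powr rate branch_max \<theta>"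
proof -
  have "R powr (1 / \<theta>) < 1" using ratio_powr_scale(4)[OF \<theta> R] R by simp
  then show ?thesis
    using covering_number_ball_le[OF x ratio_powr_scale(3)[OF \<theta> R] R(1)]
      level_exp(1)[OF R] level_exp(1)[OF ratio_powr_scale(3)[OF \<theta> R]]
    by (simp add: max_absorb2 exp_entropy_eq[OF \<theta> R])
qed

theorem assouad_spectrum_eq_rate:
  assumes \<theta>: "0 < \<theta>" "\<theta> < 1"
  shows "assouad_spectrum \<theta> (sponge n D) = rate branch_max \<theta>"
proof (rule assouad_spectrum_eqI[OF \<theta>, where c = "1 / (343 * distortion)" and C = "125 * distortion"])
  fix R :: real assume R: "0 < R" "R < 1"
  then have r: "0 < R powr (1 / \<theta>)" "R powr (1 / \<theta>) < 1" using ratio_powr_scale(3,4)[OF \<theta>, of R] by auto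
  show "\<exists>x\<in>sponge n D. 1 / (343 * distortion) * (R / R powr (1 / \<theta>)) powr rate branch_max \<theta>
      \<le> real (covering_number (cball x R \<inter> sponge n D) (R powr (1 / \<theta>)))"
    using exists_ball_entropy_le_covering_number[OF r R] distortion_pos
    unfolding exp_entropy_eq[OF \<theta> R] by (simp add: pos_divide_le_eq mult.commute mult.left_commute)
qed (use distortion_pos rate_nonneg[OF admissible_branch_max \<theta>] covering_number_ball_le_rate[OF \<theta>] in auto)

lemma covering_number_ball_ge_rate:
  assumes \<theta>: "0 < \<theta>" "\<theta> < 1" and R: "0 < R" "R < 1" and x: "x \<in> sponge n D"
  shows "1 / (343 * distortion) * (R / R powr (1 / \<theta>)) powr rate branch_min \<theta> \<le>
    real (covering_number (cball x R \<inter> sponge n D) (R powr (1 / \<theta>)))"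
proof -
  have "0 < R powr (1 / \<theta>)" "R powr (1 / \<theta>) < 1" using ratio_powr_scale(3,4)[OF \<theta> R] R by auto
  from entropy_le_covering_number_ball[OF x this R] show ?thesis
    using distortion_pos unfolding exp_entropy_eq[OF \<theta> R]
    by (simp add: pos_divide_le_eq mult.commute mult.left_commute)
qed

theorem lower_spectrum_eq_rate:
  assumes \<theta>: "0 < \<theta>" "\<theta> < 1"
  shows "lower_spectrum \<theta> (sponge n D) = rate branch_min \<theta>"
proof -
  obtain R0 where R0: "0 < R0" "\<And>r R. 0 < r \<Longrightarrow> r < 1 \<Longrightarrow> 0 < R \<Longrightarrow> R < R0 \<Longrightarrow> R < 1 \<Longrightarrow>
    \<exists>x\<in>sponge n D. real (covering_number (cball x R \<inter> sponge n D) r) \<le>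
      real (card D) ^ 6 * distortion * exp (entropy branch_min (ln (1 / R)) (ln (1 / r)))"
    using exists_ball_covering_number_le_entropy by blast
  show ?thesis
  proof (rule lower_spectrum_eqI[OF \<theta>, where c = "1 / (343 * distortion)" and C = "real (card D) ^ 6 * distortion" and ?R0.0 = R0])
    fix R :: real assume R: "0 < R" "R < R0" "R < 1"
    then have r: "0 < R powr (1 / \<theta>)" "R powr (1 / \<theta>) < 1" using ratio_powr_scale(3,4)[OF \<theta>, of R] by auto
    show "\<exists>x\<in>sponge n D. real (covering_number (cball x R \<inter> sponge n D) (R powr (1 / \<theta>))) \<le>
      real (card D) ^ 6 * distortion * (R / R powr (1 / \<theta>)) powr rate branch_min \<theta>"
      using R0(2)[OF r R] unfolding exp_entropy_eq[OF \<theta> R(1,3)] .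
  next
    show "0 < real (card D) ^ 6 * distortion"
      using distortion_pos finite_D nonempty by (simp add: card_gt_0_iff)
  qed (use distortion_pos R0(1) rate_nonneg[OF admissible_branch_min \<theta>] covering_number_ball_ge_rate[OF \<theta>] in auto)
qed

section \<open>Box, Assouad and lower dimension\<close>

text \<open>By homogeneity the logarithm of the covering number is \<open>ln (1 / r)\<close> times
  the entropy, up to a bounded error that vanishes after division by
  \<open>ln (1 / r)\<close>.\<close>

theorem box_dim_eq_entropy: "box_dim (sponge n D) = entropy branch_max 0 1"
proof -
  let ?b = "entropy branch_max 0 1"
  define N where "N r = real (covering_number (sponge n D) r)" for r
  define A where "A = ln (343 * distortion)"
  have "\<forall>\<^sub>F r in at_right (0::real). 0 < r \<and> r < 1"
    by (intro eventually_at_rightI[of 0 1]) auto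
  then have ev: "\<forall>\<^sub>F r in at_right (0::real). ?b - A / ln (1 / r) \<le> ln (N r) / ln (1 / r) \<and>
      ln (N r) / ln (1 / r) \<le> ?b + A / ln (1 / r)"
  proof eventually_elim
    case (elim r)
    let ?Y = "ln (1 / r)"
    have Y: "0 < ?Y" using elim by (simp add: ln_div)
    have E: "entropy branch_max 0 ?Y = ?Y * ?b" using entropy_scale[of ?Y branch_max 0 1] Y by simp
    have hi: "N r \<le> 343 * distortion * exp (?Y * ?b)"
    proof -
      have "N r \<le> distortion * exp (?Y * ?b)"
        using covering_number_sponge_entropy(1)[of r] elim by (simp add: E N_def)
      also have "\<dots> \<le> 343 * distortion * exp (?Y * ?b)" using distortion_pos by simp
      finally show ?thesis .
    qed
    have lo: "exp (?Y * ?b) \<le> 343 * distortion * N r"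
      using covering_number_sponge_entropy(2)[of r] elim by (simp add: E N_def)
    have "0 < 343 * distortion * N r" using lo exp_gt_zero[of "?Y * ?b"] by linarith
    then have Np: "N r > 0" using distortion_pos by (simp add: zero_less_mult_iff)
    have d: "0 < 343 * distortion" using distortion_pos by simp
    have "ln (N r) \<le> ln (343 * distortion * exp (?Y * ?b))"
      using hi Np by (intro ln_mono) auto
    also have "\<dots> = A + ?Y * ?b" unfolding A_def using d by (subst ln_mult_pos) auto
    finally have 1: "ln (N r) \<le> A + ?Y * ?b" .
    have "ln (exp (?Y * ?b)) \<le> ln (343 * distortion * N r)"
      using lo by (intro ln_mono) auto
    also have "\<dots> = A + ln (N r)" unfolding A_def using d Np by (subst ln_mult_pos) auto
    finally have 2: "?Y * ?b \<le> A + ln (N r)" by simp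
    have "?b - A / ?Y = (?Y * ?b - A) / ?Y" "?b + A / ?Y = (A + ?Y * ?b) / ?Y"
      using Y by (simp_all add: diff_divide_distrib add_divide_distrib)
    then show ?case
      using 1 2 Y divide_right_mono[of "?Y * ?b - A" "ln (N r)" ?Y] divide_right_mono[of "ln (N r)" "A + ?Y * ?b" ?Y]
      by simp
  qed
  have "filterlim (\<lambda>r::real. ln (1 / r)) at_top (at_right 0)"
  proof -
    have "filterlim (\<lambda>r::real. ln (inverse r)) at_top (at_right 0)"
      by (rule filterlim_compose[OF ln_at_top filterlim_inverse_at_top_right])
    then show ?thesis by (simp add: inverse_eq_divide)
  qed
  then have A0: "((\<lambda>r::real. A / ln (1 / r)) \<longlongrightarrow> 0) (at_right 0)"
    by (rule real_tendsto_divide_at_top[OF tendsto_const])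
  have "((\<lambda>r. ln (N r) / ln (1 / r)) \<longlongrightarrow> ?b) (at_right 0)"
  proof (rule tendsto_sandwich)
    show "((\<lambda>r::real. ?b - A / ln (1 / r)) \<longlongrightarrow> ?b) (at_right 0)"
      using tendsto_diff[OF tendsto_const A0, of ?b] by simp
    show "((\<lambda>r::real. ?b + A / ln (1 / r)) \<longlongrightarrow> ?b) (at_right 0)"
      using tendsto_add[OF tendsto_const A0, of ?b] by simp
  qed (use ev in \<open>auto elim: eventually_mono\<close>)
  then show ?thesis
    unfolding box_dim_def N_def by (intro tendsto_Lim) auto
qed

text \<open>The growth rate when no position resolves more than one new coordinate: coordinate
  \<open>q\<close> is always resolved with its predecessors fixed.\<close>

definition assouad_rate :: "(3 set \<Rightarrow> 3 set \<Rightarrow> nat) \<Rightarrow> real" where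
  "assouad_rate H = ln (H {} {1}) / ln (n $ 1) + ln (H {1} {1, 2}) / ln (n $ 2) + ln (H {1, 2} UNIV) / ln (n $ 3)"

lemma assouad_rate_nonneg: "admissible H \<Longrightarrow> 0 \<le> assouad_rate H"
  unfolding assouad_rate_def using ln_admissible(1) ln_base by (intro add_nonneg_nonneg divide_nonneg_pos) auto

text \<open>The positive parts are the lengths of the ranges of positions where \<open>a\<close> coordinates are fixed
  and \<open>b\<close> resolved; those with \<open>a < q \<le> b\<close> add up to the range between the two levels of \<open>q\<close>.\<close>

lemma gap_sums:
  fixes l1 l2 l3 k1 k2 k3 :: real
  assumes "l3 \<le> l2" "l2 \<le> l1" "k3 \<le> k2" "k2 \<le> k1" "l1 \<le> k1" "l2 \<le> k2" "l3 \<le> k3"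
  shows "max 0 (min l2 k3 - l3) + max 0 (min l1 k3 - l2) + max 0 (k3 - l1) = k3 - l3"
    "max 0 (min l1 k3 - l2) + max 0 (k3 - l1) + max 0 (min l1 k2 - max l2 k3) + max 0 (k2 - max l1 k3) = k2 - l2"
    "max 0 (k3 - l1) + max 0 (k2 - max l1 k3) + max 0 (k1 - max l1 k2) = k1 - l1"
  using assms by linarith+

text \<open>A range on which several coordinates are resolved at once is compared with resolving
  them one at a time by the chain inequality for \<open>H\<close>. After regrouping by coordinate,
  \<open>gap_sums\<close> turns the range lengths into full level differences.\<close>

lemma entropy_compare:
  assumes "0 \<le> x" "x \<le> y"
  shows "(\<And>S U T. S \<subseteq> U \<Longrightarrow> U \<subseteq> T \<Longrightarrow> ln (H S T) \<le> ln (real (H S U)) + ln (H U T)) \<Longrightarrow>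
      entropy H x y \<le> assouad_rate H * (y - x)"
    and "(\<And>S U T. S \<subseteq> U \<Longrightarrow> U \<subseteq> T \<Longrightarrow> ln (real (H S U)) + ln (H U T) \<le> ln (H S T)) \<Longrightarrow>
      assouad_rate H * (y - x) \<le> entropy H x y"
proof -
  define l where "l q = x / ln (real (n $ q))" for q
  define k where "k q = y / ln (real (n $ q))" for q
  have lk: "l q \<le> k q" for q
    unfolding l_def k_def using assms ln_base(4)[of q] by (intro divide_right_mono) auto
  have ord: "l 3 \<le> l 2" "l 2 \<le> l 1" "k 3 \<le> k 2" "k 2 \<le> k 1"
    unfolding l_def k_def using ln_base_divide_mono assms by auto
  define e23 where "e23 = max 0 (min (l 2) (k 3) - l 3)"
  define e13 where "e13 = max 0 (min (l 1) (k 3) - l 2)"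
  define e03 where "e03 = max 0 (k 3 - l 1)"
  define e12 where "e12 = max 0 (min (l 1) (k 2) - max (l 2) (k 3))"
  define e02 where "e02 = max 0 (k 2 - max (l 1) (k 3))"
  define e01 where "e01 = max 0 (k 1 - max (l 1) (k 2))"
  note e = e23_def e13_def e03_def e12_def e02_def e01_def
  have pos: "0 \<le> e13" "0 \<le> e03" "0 \<le> e02" by (auto simp: e)
  define c where "c S T = ln (real (H S T))" for S T :: "3 set"
  have E: "entropy H x y = c {1, 2} UNIV * e23 + c {1} UNIV * e13 + c {} UNIV * e03 +
      c {1} {1, 2} * e12 + c {} {1, 2} * e02 + c {} {1} * e01"
    by (simp add: entropy_def e l_def k_def c_def)
  have "assouad_rate H * (y - x) = c {1, 2} UNIV * (k 3 - l 3) + c {1} {1, 2} * (k 2 - l 2) + c {} {1} * (k 1 - l 1)"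
    by (simp add: assouad_rate_def k_def l_def c_def diff_divide_distrib algebra_simps)
  also have "\<dots> = c {1, 2} UNIV * (e23 + e13 + e03) + c {1} {1, 2} * (e13 + e03 + e12 + e02) +
      c {} {1} * (e03 + e02 + e01)"
    using gap_sums[OF ord lk lk lk] by (simp add: e)
  also have "\<dots> = c {1, 2} UNIV * e23 + (c {1} {1, 2} + c {1, 2} UNIV) * e13 +
      (c {} {1} + (c {1} {1, 2} + c {1, 2} UNIV)) * e03 + c {1} {1, 2} * e12 + (c {} {1} + c {1} {1, 2}) * e02 + c {} {1} * e01"
    by (simp add: algebra_simps)
  finally have R: "assouad_rate H * (y - x) = \<dots>" .
  show "entropy H x y \<le> assouad_rate H * (y - x)"
    if "\<And>S U T. S \<subseteq> U \<Longrightarrow> U \<subseteq> T \<Longrightarrow> ln (H S T) \<le> ln (real (H S U)) + ln (H U T)"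
  proof -
    have c: "c S T \<le> c S U + c U T" if "S \<subseteq> U" "U \<subseteq> T" for S U T
      using \<open>\<And>S U T. S \<subseteq> U \<Longrightarrow> U \<subseteq> T \<Longrightarrow> _\<close> that by (simp add: c_def)
    have "c {1} UNIV \<le> c {1} {1, 2} + c {1, 2} UNIV" "c {} {1, 2} \<le> c {} {1} + c {1} {1, 2}" "c {} UNIV \<le> c {} {1} + c {1} UNIV"
      by (auto intro: c)
    then show ?thesis unfolding E R by (intro add_mono mult_right_mono order_refl pos) auto
  qed
  show "assouad_rate H * (y - x) \<le> entropy H x y"
    if "\<And>S U T. S \<subseteq> U \<Longrightarrow> U \<subseteq> T \<Longrightarrow> ln (real (H S U)) + ln (H U T) \<le> ln (H S T)"
  proof -
    have c: "c S U + c U T \<le> c S T" if "S \<subseteq> U" "U \<subseteq> T" for S U T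
      using \<open>\<And>S U T. S \<subseteq> U \<Longrightarrow> U \<subseteq> T \<Longrightarrow> _\<close> that by (simp add: c_def)
    have "c {1} {1, 2} + c {1, 2} UNIV \<le> c {1} UNIV" "c {} {1} + c {1} {1, 2} \<le> c {} {1, 2}" "c {} {1} + c {1} UNIV \<le> c {} UNIV"
      by (auto intro: c)
    then show ?thesis unfolding E R by (intro add_mono mult_right_mono order_refl pos) auto
  qed
qed

end

section \<open>Sub- and supermultiplicativity of the branch numbers\<close>

lemma card_image_ge_fibres:
  assumes "finite W" "\<And>x. x \<in> W \<Longrightarrow> M \<le> card (f ` {y \<in> W. g y = g x})"
    and "\<And>x y. x \<in> W \<Longrightarrow> y \<in> W \<Longrightarrow> f x = f y \<Longrightarrow> g x = g y"
  shows "card (g ` W) * M \<le> card (f ` W)"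
proof -
  have "card (g ` W) * M \<le> (\<Sum>t\<in>g ` W. card (f ` {y \<in> W. g y = t}))"
    using assms(2) sum_bounded_below[of "g ` W" M "\<lambda>t. card (f ` {y \<in> W. g y = t})"] by auto
  also have "\<dots> = card (\<Union>t\<in>g ` W. f ` {y \<in> W. g y = t})"
  \<comment> \<open>Since \<open>f\<close> determines \<open>g\<close>, different fibres of
    \<open>g\<close> have disjoint images under \<open>f\<close>, so their sizes add up.\<close>
  proof (rule card_UN_disjoint[symmetric])
    show "\<forall>t\<in>g ` W. \<forall>u\<in>g ` W. t \<noteq> u \<longrightarrow> f ` {y \<in> W. g y = t} \<inter> f ` {y \<in> W. g y = u} = {}"
    proof (intro ballI impI equals0I)
      fix t u z assume "t \<noteq> u" "z \<in> f ` {y \<in> W. g y = t} \<inter> f ` {y \<in> W. g y = u}"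
      then obtain x y where "x \<in> W" "y \<in> W" "f x = f y" "g x \<noteq> g y" by auto
      then show False using assms(3) by blast
    qed
  qed (use assms(1) in auto)
  also have "(\<Union>t\<in>g ` W. f ` {y \<in> W. g y = t}) = f ` W" by blast
  finally show ?thesis .
qed

lemma card_image_cong_kernel:
  assumes "finite W" "\<And>x y. x \<in> W \<Longrightarrow> y \<in> W \<Longrightarrow> f x = f y \<longleftrightarrow> g x = g y"
  shows "card (f ` W) = card (g ` W)"
  by (intro antisym card_image_le_factor(2)) (use assms in auto)

context digit_sponge
begin

lemma branch_fibre:
  assumes "S \<subseteq> U" "x \<in> {i' \<in> D. trunc S i' = trunc S i}"
  shows "card (trunc T ` {y \<in> {i' \<in> D. trunc S i' = trunc S i}. trunc U y = trunc U x}) = branch U T x"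
proof -
  have "{y \<in> {i' \<in> D. trunc S i' = trunc S i}. trunc U y = trunc U x} = {i' \<in> D. trunc U i' = trunc U x}"
    using assms by (auto simp: trunc_eq_iff)
  then show ?thesis by (simp add: branch_def)
qed

text \<open>Resolve \<open>U\<close> first and then \<open>T\<close>: the first choice splits the
  letters into classes with \<open>U\<close> fixed, each bounded by the maximum for \<open>U\<close>
  and \<open>T\<close>.\<close>

lemma branch_max_submult:
  assumes "S \<subseteq> U"
  shows "branch_max S T \<le> branch_max S U * branch_max U T"
proof -
  obtain i where i: "i \<in> D" "branch S T i = branch_max S T" using branch_max_witness by blast
  let ?W = "{i' \<in> D. trunc S i' = trunc S i}"
  have "branch S T i \<le> card (trunc U ` ?W) * branch_max U T"
    unfolding branch_def[of S T]
  proof (rule card_image_le_fibres)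
    show "finite (trunc U ` ?W)" using finite_D by simp
    show "card (trunc T ` {y \<in> ?W. trunc U y = trunc U x}) \<le> branch_max U T" if "x \<in> ?W" for x
      unfolding branch_fibre[OF assms that] using that by (auto intro: branch_le_max)
  qed
  also have "card (trunc U ` ?W) \<le> branch_max S U"
    using branch_le_max[OF i(1), of S U] by (simp add: branch_def)
  finally show ?thesis unfolding i(2) by simp
qed

text \<open>The same splitting bounds the count from below; \<open>U \<subseteq> T\<close>
  guarantees that different classes yield different truncations to \<open>T\<close>.\<close>

lemma branch_min_supermult:
  assumes "S \<subseteq> U" "U \<subseteq> T"
  shows "branch_min S U * branch_min U T \<le> branch_min S T"
proof -
  obtain i where i: "i \<in> D" "branch S T i = branch_min S T" using branch_min_witness by blast
  let ?W = "{i' \<in> D. trunc S i' = trunc S i}"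
  have "branch_min S U \<le> card (trunc U ` ?W)"
    using branch_min_le[OF i(1), of S U] by (simp add: branch_def)
  then have "branch_min S U * branch_min U T \<le> card (trunc U ` ?W) * branch_min U T" by simp
  also have "\<dots> \<le> branch S T i"
    unfolding branch_def[of S T]
  proof (rule card_image_ge_fibres)
    show "finite ?W" using finite_D by simp
    show "branch_min U T \<le> card (trunc T ` {y \<in> ?W. trunc U y = trunc U x})" if "x \<in> ?W" for x
      unfolding branch_fibre[OF assms(1) that] using that by (auto intro: branch_min_le)
    show "trunc U x = trunc U y" if "trunc T x = trunc T y" for x y
      using that assms(2) by (auto simp: trunc_eq_iff)
  qed
  finally show ?thesis unfolding i(2) .
qed

end

context digit_sponge3
begin

lemma ln_branch_submult:
  assumes "S \<subseteq> U" "U \<subseteq> T"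
  shows "ln (branch_max S T) \<le> ln (real (branch_max S U)) + ln (branch_max U T)"
    "ln (real (branch_min S U)) + ln (branch_min U T) \<le> ln (branch_min S T)"
proof -
  have p: "0 < branch_max S T" "0 < branch_min S T" for S T
    using admissible_branch_max admissible_branch_min by (auto simp: admissible_def Suc_le_eq)
  have "real (branch_max S T) \<le> real (branch_max S U * branch_max U T)"
    unfolding of_nat_le_iff by (rule branch_max_submult[OF assms(1)])
  then have "ln (branch_max S T) \<le> ln (real (branch_max S U * branch_max U T))"
    using p by (intro ln_mono) auto
  also have "\<dots> = ln (real (branch_max S U)) + ln (branch_max U T)"
    unfolding of_nat_mult using p by (intro ln_mult_pos) simp_all
  finally show "ln (branch_max S T) \<le> ln (real (branch_max S U)) + ln (branch_max U T)" .
  have "real (branch_min S U * branch_min U T) \<le> real (branch_min S T)"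
    unfolding of_nat_le_iff by (rule branch_min_supermult[OF assms])
  then have "ln (real (branch_min S U * branch_min U T)) \<le> ln (branch_min S T)"
    using p by (intro ln_mono) auto
  moreover have "ln (real (branch_min S U * branch_min U T)) = ln (real (branch_min S U)) + ln (branch_min U T)"
    unfolding of_nat_mult using p by (intro ln_mult_pos) simp_all
  ultimately show "ln (real (branch_min S U)) + ln (branch_min U T) \<le> ln (branch_min S T)" by simp
qed

lemma assouad_dim_bounds:
  assumes \<theta>: "0 < \<theta>" "\<theta> < 1"
  shows "assouad_spectrum \<theta> (sponge n D) \<le> assouad_dim (sponge n D)"
    "assouad_dim (sponge n D) \<le> assouad_rate branch_max"
proof -
  have "real (covering_number (cball x R \<inter> sponge n D) r) \<le> 125 * distortion * (R / r) powr assouad_rate branch_max"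
    if "0 < r" "r < R" "x \<in> sponge n D" for r R x
  proof -
    let ?X = "max 0 (ln (1 / R))" and ?Y = "max 0 (ln (1 / r))"
    have "ln (1 / R) \<le> ln (1 / r)" using that by (intro ln_mono divide_left_mono) auto
    then have XY: "0 \<le> ?X" "?X \<le> ?Y" by auto
    \<comment> \<open>Clamping at 0 does not increase distances, which also settles radii above
      1.\<close>
    have "?Y - ?X \<le> ln (1 / r) - ln (1 / R)" using \<open>ln (1 / R) \<le> ln (1 / r)\<close> by linarith
    also have "\<dots> = ln (R / r)" using that by (simp add: ln_div)
    finally have "assouad_rate branch_max * (?Y - ?X) \<le> assouad_rate branch_max * ln (R / r)"
      using assouad_rate_nonneg[OF admissible_branch_max] by (intro mult_left_mono) auto
    then have "entropy branch_max ?X ?Y \<le> assouad_rate branch_max * ln (R / r)"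
      using entropy_compare(1)[OF XY, of branch_max, OF ln_branch_submult(1)] by linarith
    then have "exp (entropy branch_max ?X ?Y) \<le> (R / r) powr assouad_rate branch_max"
      using that by (simp add: powr_def)
    then have "125 * distortion * exp (entropy branch_max ?X ?Y) \<le> 125 * distortion * (R / r) powr assouad_rate branch_max"
      using distortion_pos by (intro mult_left_mono) auto
    with covering_number_ball_le[OF that(3,1), of R] that show ?thesis by linarith
  qed
  note * = assouad_spectrum_le_assouad_dim[OF \<theta> _ assouad_rate_nonneg[OF admissible_branch_max] this]
  show "assouad_spectrum \<theta> (sponge n D) \<le> assouad_dim (sponge n D)"
    using distortion_pos by (intro *) auto
  show "assouad_dim (sponge n D) \<le> assouad_rate branch_max"
    using distortion_pos by (intro *) auto
qed

lemma lower_dim_bounds: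
  assumes \<theta>: "0 < \<theta>" "\<theta> < 1"
  shows "lower_dim (sponge n D) \<le> lower_spectrum \<theta> (sponge n D)"
    "assouad_rate branch_min \<le> lower_dim (sponge n D)"
proof -
  have lo: "1 / (343 * distortion) * (R / r) powr assouad_rate branch_min \<le>
      real (covering_number (cball x R \<inter> sponge n D) r)"
    if "0 < r" "r < R" "R < 1" "x \<in> sponge n D" for r R x
  proof -
    let ?X = "ln (1 / R)" and ?Y = "ln (1 / r)"
    have XY: "0 \<le> ?X" "?X \<le> ?Y" using that by (auto intro!: ln_mono divide_left_mono simp: ln_div)
    have "?Y - ?X = ln (R / r)" using that by (simp add: ln_div)
    then have "assouad_rate branch_min * ln (R / r) \<le> entropy branch_min ?X ?Y"
      using entropy_compare(2)[OF XY, of branch_min, OF ln_branch_submult(2)] by simp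
    then have "(R / r) powr assouad_rate branch_min \<le> exp (entropy branch_min ?X ?Y)"
      using that by (simp add: powr_def)
    also have "\<dots> \<le> 343 * distortion * real (covering_number (cball x R \<inter> sponge n D) r)"
      using that by (intro entropy_le_covering_number_ball) auto
    finally show ?thesis
      using distortion_pos by (simp add: pos_divide_le_eq mult.commute mult.left_commute)
  qed
  have ne: "sponge n D \<noteq> {}" using words_nonempty by (simp add: sponge_eq)
  note * = lower_dim_le_lower_spectrum[OF \<theta> _ assouad_rate_nonneg[OF admissible_branch_min] ne lo
      covering_number_ball_le_rate[OF \<theta>]]
  show "lower_dim (sponge n D) \<le> lower_spectrum \<theta> (sponge n D)"
    using distortion_pos by (intro *) auto
  show "assouad_rate branch_min \<le> lower_dim (sponge n D)"
    using distortion_pos by (intro *) auto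
qed

section \<open>The numbers of branches in three dimensions\<close>

lemma finite_fibre: "finite {i' \<in> D. P i'}"
  using finite_D by simp

text \<open>Truncations and digit projections have the same kernels, hence images of equal size. For
  \<open>column_sum\<close>, the letters with a given first digit are grouped by their second
  digit.\<close>

lemma branch_card:
  assumes "i \<in> D"
  shows "branch {} {1} i = card (proj1 D)" "branch {} {1, 2} i = card (proj2 D)" "branch {} UNIV i = card D"
    "branch {1} {1, 2} i = fibre1 n D (i $ 1)" "branch {1, 2} UNIV i = fibre2 n D (i $ 1, i $ 2)"
    "branch {1} UNIV i = column_sum n D (i $ 1)"
proof -
  have 0: "{i' \<in> D. trunc {} i' = trunc {} i} = D"
    and 1: "{i' \<in> D. trunc {1} i' = trunc {1} i} = {i' \<in> D. i' $ 1 = i $ 1}"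
    and 2: "\<And>i. {i' \<in> D. trunc {1, 2} i' = trunc {1, 2} i} = {i' \<in> D. i' $ 1 = i $ 1 \<and> i' $ 2 = i $ 2}"
    by (auto simp: trunc_eq_iff)
  have inj: "inj_on (trunc UNIV) A" for A :: "(nat ^ 3) set"
    by (auto simp: inj_on_def trunc_def vec_eq_iff)
  have digit: "i $ q < n $ q" if "i \<in> D" for i q using digits that by (auto simp: digit_box_def)
  have p2: "(a, b) \<in> proj2 D \<longleftrightarrow> (\<exists>j\<in>D. a = j $ 1 \<and> b = j $ 2)" for a b
    by (auto simp: proj2_def)
  show "branch {} {1} i = card (proj1 D)"
    unfolding branch_def 0 proj1_def by (rule card_image_cong_kernel[OF finite_D]) (auto simp: trunc_eq_iff)
  show "branch {} {1, 2} i = card (proj2 D)"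
    unfolding branch_def 0 proj2_def by (rule card_image_cong_kernel[OF finite_D]) (auto simp: trunc_eq_iff)
  show "branch {} UNIV i = card D"
    unfolding branch_def 0 by (rule card_image[OF inj])
  have "branch {1} {1, 2} i = card ((\<lambda>i'. i' $ 2) ` {i' \<in> D. i' $ 1 = i $ 1})"
    unfolding branch_def 1 by (rule card_image_cong_kernel[OF finite_fibre]) (auto simp: trunc_eq_iff)
  also have "(\<lambda>i'. i' $ 2) ` {i' \<in> D. i' $ 1 = i $ 1} = {i2. i2 < n $ 2 \<and> (i $ 1, i2) \<in> proj2 D}"
    by (auto simp: p2 digit image_iff) metis
  finally show "branch {1} {1, 2} i = fibre1 n D (i $ 1)" by (simp add: fibre1_def)
  have vec: "vector [j $ 1, j $ 2, j $ 3] = j" for j :: "nat ^ 3"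
    by (simp add: vec_eq_iff forall_3)
  have f2: "branch {1, 2} UNIV i = fibre2 n D (i $ 1, i $ 2)" for i
  proof -
    have "branch {1, 2} UNIV i = card ((\<lambda>i'. i' $ 3) ` {i' \<in> D. i' $ 1 = i $ 1 \<and> i' $ 2 = i $ 2})"
      unfolding branch_def 2 by (rule card_image_cong_kernel[OF finite_fibre]) (auto simp: trunc_eq_iff forall_3)
    also have "(\<lambda>i'. i' $ 3) ` {i' \<in> D. i' $ 1 = i $ 1 \<and> i' $ 2 = i $ 2} =
        {i3. i3 < n $ 3 \<and> vector [i $ 1, i $ 2, i3] \<in> D}"
    proof (intro equalityI subsetI)
      fix i3 assume "i3 \<in> (\<lambda>i'. i' $ 3) ` {i' \<in> D. i' $ 1 = i $ 1 \<and> i' $ 2 = i $ 2}"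
      then obtain j where "j \<in> D" "j $ 1 = i $ 1" "j $ 2 = i $ 2" "i3 = j $ 3" by auto
      then show "i3 \<in> {i3. i3 < n $ 3 \<and> vector [i $ 1, i $ 2, i3] \<in> D}"
        using vec[of j] digit[of j 3] by simp
    next
      fix i3 assume "i3 \<in> {i3. i3 < n $ 3 \<and> vector [i $ 1, i $ 2, i3] \<in> D}"
      then show "i3 \<in> (\<lambda>i'. i' $ 3) ` {i' \<in> D. i' $ 1 = i $ 1 \<and> i' $ 2 = i $ 2}"
        by (intro image_eqI[of _ _ "vector [i $ 1, i $ 2, i3]"]) auto
    qed
    finally show ?thesis by (simp add: fibre2_def)
  qed
  then show "branch {1, 2} UNIV i = fibre2 n D (i $ 1, i $ 2)" .
  let ?W = "{i' \<in> D. i' $ 1 = i $ 1}"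
  have "branch {1} UNIV i = (\<Sum>i'\<in>?W. 1)"
    unfolding branch_def 1 using card_image[OF inj] by simp
  also have "\<dots> = (\<Sum>i2\<in>(\<lambda>i'. i' $ 2) ` ?W. \<Sum>i' | i' \<in> ?W \<and> i' $ 2 = i2. 1)"
    by (rule sum.image_gen[OF finite_fibre])
  also have "\<dots> = (\<Sum>i2\<in>(\<lambda>i'. i' $ 2) ` ?W. fibre2 n D (i $ 1, i2))"
  proof (rule sum.cong)
    fix i2 assume "i2 \<in> (\<lambda>i'. i' $ 2) ` ?W"
    then obtain j where j: "j \<in> D" "j $ 1 = i $ 1" "i2 = j $ 2" by auto
    have "fibre2 n D (j $ 1, j $ 2) = card {i' \<in> D. i' $ 1 = j $ 1 \<and> i' $ 2 = j $ 2}"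
      unfolding f2[symmetric] branch_def 2 by (rule card_image[OF inj])
    then show "(\<Sum>i' | i' \<in> ?W \<and> i' $ 2 = i2. 1) = fibre2 n D (i $ 1, i2)"
      using j by (simp add: conj_ac)
  qed simp
  also have "(\<lambda>i'. i' $ 2) ` ?W = {i2. (i $ 1, i2) \<in> proj2 D}"
    by (auto simp: p2 image_iff) metis
  finally show "branch {1} UNIV i = column_sum n D (i $ 1)" by (simp add: column_sum_def)
qed

text \<open>With no coordinate fixed the branch number is constant, so maximum and minimum coincide;
  therefore \<open>f1\<close>, \<open>f2\<close>, \<open>f3\<close> and \<open>g1\<close>,
  \<open>g2\<close>, \<open>g3\<close> differ only in \<open>C\<close>, \<open>M\<close>,
  \<open>N\<close>.\<close>

lemma branch_extrema:
  "branch_max {} {1} = card (proj1 D)" "branch_min {} {1} = card (proj1 D)"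
  "branch_max {} {1, 2} = card (proj2 D)" "branch_min {} {1, 2} = card (proj2 D)"
  "branch_max {} UNIV = card D" "branch_min {} UNIV = card D"
  "branch_max {1} {1, 2} = M_max n D" "branch_min {1} {1, 2} = M_min n D"
  "branch_max {1, 2} UNIV = N_max n D" "branch_min {1, 2} UNIV = N_min n D"
  "branch_max {1} UNIV = C_max n D" "branch_min {1} UNIV = C_min n D"
proof -
  have const: "f ` D = {c}" if "\<And>i. i \<in> D \<Longrightarrow> f i = c" for f :: "nat ^ 3 \<Rightarrow> nat" and c
    using that nonempty by auto
  show "branch_max {} {1} = card (proj1 D)" "branch_min {} {1} = card (proj1 D)"
    "branch_max {} {1, 2} = card (proj2 D)" "branch_min {} {1, 2} = card (proj2 D)"
    "branch_max {} UNIV = card D" "branch_min {} UNIV = card D"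
    unfolding branch_max_def branch_min_def
    by (simp_all only: const[OF branch_card(1)] const[OF branch_card(2)] const[OF branch_card(3)] Max_singleton Min_singleton)
  have "branch {1} {1, 2} ` D = fibre1 n D ` proj1 D"
    unfolding proj1_def image_image by (rule image_cong[OF refl branch_card(4)])
  then show "branch_max {1} {1, 2} = M_max n D" "branch_min {1} {1, 2} = M_min n D"
    by (simp_all only: branch_max_def branch_min_def M_max_def M_min_def)
  have "branch {1, 2} UNIV ` D = fibre2 n D ` proj2 D"
    unfolding proj2_def image_image by (rule image_cong[OF refl branch_card(5)])
  then show "branch_max {1, 2} UNIV = N_max n D" "branch_min {1, 2} UNIV = N_min n D"
    by (simp_all only: branch_max_def branch_min_def N_max_def N_min_def)
  have "branch {1} UNIV ` D = column_sum n D ` proj1 D"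
    unfolding proj1_def image_image by (rule image_cong[OF refl branch_card(6)])
  then show "branch_max {1} UNIV = C_max n D" "branch_min {1} UNIV = C_min n D"
    by (simp_all only: branch_max_def branch_min_def C_max_def C_min_def)
qed

section \<open>The four ranges of the parameter\<close>

lemma box_dim_eq:
  "box_dim (sponge n D) = ln (card (proj1 D)) / ln (n $ 1) + (ln (card (proj2 D)) - ln (card (proj1 D))) / ln (n $ 2)
    + (ln (card D) - ln (card (proj2 D))) / ln (n $ 3)"
proof -
  \<comment> \<open>At \<open>x = 0\<close> all coarse levels vanish; the order of the fine ones
    leaves only the three terms with no coordinate fixed.\<close>
  have 1: "0 \<le> 1 / ln (real (n $ 3))" "1 / ln (real (n $ 3)) \<le> 1 / ln (real (n $ 2))"
    "1 / ln (real (n $ 2)) \<le> 1 / ln (real (n $ 1))"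
    using ln_base_divide_mono[of 1] ln_base(4)[of 3] by auto
  then have "0 \<le> 1 / ln (real (n $ 2))" "0 \<le> 1 / ln (real (n $ 1))" by linarith+
  with 1 show ?thesis
    unfolding box_dim_eq_entropy entropy_def branch_extrema
    by (simp add: max_def min_def diff_divide_distrib algebra_simps)
qed

text \<open>In units of \<open>ln (1 / R)\<close> the coarse levels are \<open>a1\<close>,
  \<open>a2\<close>, \<open>a3\<close> and the fine ones \<open>w\<close>, \<open>v\<close>,
  \<open>u\<close>. A break point is a value of \<open>\<theta>\<close> at which a fine level meets
  a coarse level of another coordinate; between break points the order is fixed and every
  \<open>max\<close> and \<open>min\<close> resolves.\<close>

lemma rate_cases:
  assumes H: "admissible H" "H {} {1} = card (proj1 D)" "H {} {1, 2} = card (proj2 D)" "H {} UNIV = card D"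
    and \<theta>: "0 < \<theta>" "\<theta> < 1"
    and ratio: "ln (n $ 1) / ln (n $ 2) < ln (n $ 2) / ln (n $ 3)"
  shows "\<theta> \<le> ln (n $ 1) / ln (n $ 3) \<Longrightarrow> rate H \<theta> = formula1 n D (H {1} UNIV) (H {1, 2} UNIV) \<theta>"
    "ln (n $ 1) / ln (n $ 3) < \<theta> \<Longrightarrow> \<theta> \<le> ln (n $ 1) / ln (n $ 2) \<Longrightarrow>
      rate H \<theta> = formula2 n D (H {1} UNIV) (H {1} {1, 2}) (H {1, 2} UNIV) \<theta>"
    "ln (n $ 1) / ln (n $ 2) < \<theta> \<Longrightarrow> \<theta> \<le> ln (n $ 2) / ln (n $ 3) \<Longrightarrow>
      rate H \<theta> = formula3 n D (H {1} UNIV) (H {1} {1, 2}) (H {1, 2} UNIV) \<theta>"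
    "ln (n $ 2) / ln (n $ 3) < \<theta> \<Longrightarrow> rate H \<theta> = assouad_rate H"
proof -
  define a1 where "a1 = 1 / ln (real (n $ 1))"
  define a2 where "a2 = 1 / ln (real (n $ 2))"
  define a3 where "a3 = 1 / ln (real (n $ 3))"
  define t where "t = 1 / \<theta>"
  have t: "1 < t" "\<theta> = 1 / t" using \<theta> by (auto simp: t_def)
  have a: "0 < a3" "a3 < a2" "a2 < a1"
    unfolding a1_def a2_def a3_def using ln_base by (auto intro!: divide_strict_left_mono)
  have div: "x / ln (real (n $ 1)) = x * a1" "x / ln (real (n $ 2)) = x * a2" "x / ln (real (n $ 3)) = x * a3" for x
    by (simp_all add: a1_def a2_def a3_def)
  define u where "u = t * a3"
  define v where "v = t * a2"
  define w where "w = t * a1"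
  have ta: "a3 < u" "a2 < v" "a1 < w" "u < v" "v < w"
    using t a by (simp_all add: u_def v_def w_def)
  have iff: "\<theta> \<le> ln (n $ 1) / ln (n $ 3) \<longleftrightarrow> a1 \<le> u" "\<theta> \<le> ln (n $ 1) / ln (n $ 2) \<longleftrightarrow> a1 \<le> v"
    "\<theta> \<le> ln (n $ 2) / ln (n $ 3) \<longleftrightarrow> a2 \<le> u"
    unfolding u_def v_def a1_def a2_def a3_def t_def using ln_base(4)[of 1] ln_base(4)[of 2] ln_base(4)[of 3] \<theta>
    by (auto simp: field_simps)
  have c: "0 < real (H S T)" for S T using H(1) by (force simp: admissible_def intro: Suc_le_lessD)
  define p where "p = ln (real (card (proj1 D)))"
  define p2 where "p2 = ln (real (card (proj2 D)))"
  define d where "d = ln (real (card D))"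
  define C where "C = ln (real (H {1} UNIV))"
  define M where "M = ln (real (H {1} {1, 2}))"
  define N where "N = ln (real (H {1, 2} UNIV))"
  have pos: "0 < real (card (proj1 D))" "0 < real (card (proj2 D))" "0 < real (card D)"
    using c[of "{}" "{1}"] c[of "{}" "{1, 2}"] c[of "{}" UNIV] unfolding H by auto
  have E: "entropy H 1 t = N * max 0 (min a2 (u) - a3) + C * max 0 (min a1 (u) - a2) +
      d * max 0 (u - a1) + M * max 0 (min a1 (v) - max a2 (u)) +
      p2 * max 0 (v - max a1 (u)) + p * max 0 (w - max a1 (v))"
    unfolding entropy_def H div u_def v_def w_def p_def p2_def d_def C_def M_def N_def mult_1 ..
  have r: "rate H \<theta> = entropy H 1 t / (t - 1)" by (simp add: rate_def t_def)
  have lnd: "ln (real (card D) / real (H {1} UNIV)) = d - C" "ln (real (H {1} UNIV) / real (H {1, 2} UNIV)) = C - N"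
    "ln (real (card (proj2 D)) / real (card (proj1 D))) = p2 - p" "ln (real (H {1} UNIV) / real (H {1} {1, 2})) = C - M"
    "ln (real (card (proj2 D)) / real (H {1} {1, 2})) = p2 - M"
    using c pos by (simp_all add: ln_div p_def p2_def d_def C_def M_def N_def)
  have fold: "ln (real (card (proj1 D))) = p" "ln (real (card (proj2 D))) = p2" "ln (real (card D)) = d"
    "ln (real (H {1} {1, 2})) = M" "ln (real (H {1, 2} UNIV)) = N"
    by (simp_all add: p_def p2_def d_def M_def N_def)
  have t1: "t - 1 \<noteq> 0" "t \<noteq> 0" using t by auto
  \<comment> \<open>Since \<open>\<theta> = 1 / t\<close>, the denominators satisfy
    \<open>t - 1 = t * (1 - \<theta>)\<close>.\<close>
  have quot: "x / (t - 1) = y / (1 - \<theta>)" if "x = t * y" for x y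
    unfolding that t(2) using t1 by (simp add: field_simps)
  have ord: "a2 \<le> u \<or> v < a1"
    using ratio iff(2,3) \<theta> by force
  show "rate H \<theta> = formula1 n D (H {1} UNIV) (H {1, 2} UNIV) \<theta>" if "\<theta> \<le> ln (n $ 1) / ln (n $ 3)"
  proof -
    have "a1 \<le> u" using that iff by simp
    moreover from this have "a1 \<le> v" "a2 \<le> u" using a ta by linarith+
    ultimately have e: "entropy H 1 t = N * (a2 - a3) + C * (a1 - a2) + d * (u - a1) + p2 * (v - u) + p * (w - v)"
      unfolding E using a ta by (simp add: max_def min_def)
    show ?thesis
      unfolding r formula1_def box_dim_eq div lnd fold
      using t1 by (intro quot) (simp add: e t(2) u_def v_def w_def field_simps)
  qed
  show "rate H \<theta> = formula2 n D (H {1} UNIV) (H {1} {1, 2}) (H {1, 2} UNIV) \<theta>"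
    if "ln (n $ 1) / ln (n $ 3) < \<theta>" "\<theta> \<le> ln (n $ 1) / ln (n $ 2)"
  proof -
    have "u < a1" "a1 \<le> v" using that iff by auto
    moreover from this have "a2 \<le> u" using ord by linarith
    ultimately have e: "entropy H 1 t = N * (a2 - a3) + C * (u - a2) + M * (a1 - u) + p2 * (v - a1) + p * (w - v)"
      unfolding E using a ta ord by (simp add: max_def min_def)
    show ?thesis
      unfolding r formula2_def div lnd fold
      using t1 by (intro quot) (simp add: e t(2) u_def v_def w_def field_simps)
  qed
  show "rate H \<theta> = formula3 n D (H {1} UNIV) (H {1} {1, 2}) (H {1, 2} UNIV) \<theta>"
    if "ln (n $ 1) / ln (n $ 2) < \<theta>" "\<theta> \<le> ln (n $ 2) / ln (n $ 3)"
  proof -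
    have "v < a1" "a2 \<le> u" using that iff by auto
    moreover from this have "u < a1" using ta by linarith
    ultimately have e: "entropy H 1 t = (t - 1) * (p * a1) + (N * (a2 - a3) + C * (u - a2) + M * (v - u))"
      unfolding E using a ta by (simp add: max_def min_def) (simp add: u_def v_def w_def algebra_simps)
    have "(N * (a2 - a3) + C * (u - a2) + M * (v - u)) / (t - 1) =
        (M * a2 + (C - M) * a3 - \<theta> * ((C - N) * a2 + N * a3)) / (1 - \<theta>)"
      using t1 by (intro quot) (simp add: t(2) u_def v_def w_def field_simps)
    then show ?thesis
      unfolding r formula3_def div lnd fold e add_divide_distrib using t1 by simp
  qed
  show "rate H \<theta> = assouad_rate H" if "ln (n $ 2) / ln (n $ 3) < \<theta>"
  proof -
    \<comment> \<open>Now \<open>a3 < u < a2 < v < a1 < w\<close>: the ranges between the coarse and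
      fine levels of the three coordinates are disjoint, and only one-coordinate terms
      survive.\<close>
    have "u < a2" "v < a1" using that iff ord by auto
    moreover from this have "u < a1" using ta by linarith
    ultimately have "entropy H 1 t = (t - 1) * (N * a3 + M * a2 + p * a1)"
      unfolding E using a ta by (simp add: max_def min_def) (simp add: u_def v_def w_def algebra_simps)
    then show ?thesis
      unfolding r assouad_rate_def H div fold using t1 by simp
  qed
qed

theorem spectra:
  assumes ratio: "ln (n $ 1) / ln (n $ 2) < ln (n $ 2) / ln (n $ 3)" and \<theta>: "0 < \<theta>" "\<theta> < 1"
  shows "\<theta> \<le> ln (n $ 1) / ln (n $ 3) \<Longrightarrow>
      assouad_spectrum \<theta> (sponge n D) = f1 n D \<theta> \<and> lower_spectrum \<theta> (sponge n D) = g1 n D \<theta>"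
    "ln (n $ 1) / ln (n $ 3) < \<theta> \<Longrightarrow> \<theta> \<le> ln (n $ 1) / ln (n $ 2) \<Longrightarrow>
      assouad_spectrum \<theta> (sponge n D) = f2 n D \<theta> \<and> lower_spectrum \<theta> (sponge n D) = g2 n D \<theta>"
    "ln (n $ 1) / ln (n $ 2) < \<theta> \<Longrightarrow> \<theta> \<le> ln (n $ 2) / ln (n $ 3) \<Longrightarrow>
      assouad_spectrum \<theta> (sponge n D) = f3 n D \<theta> \<and> lower_spectrum \<theta> (sponge n D) = g3 n D \<theta>"
    "ln (n $ 2) / ln (n $ 3) < \<theta> \<Longrightarrow>
      assouad_spectrum \<theta> (sponge n D) = assouad_dim (sponge n D) \<and>
      lower_spectrum \<theta> (sponge n D) = lower_dim (sponge n D)"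
proof -
  note mx = rate_cases[OF admissible_branch_max branch_extrema(1,3,5) \<theta> ratio, unfolded branch_extrema]
  note mn = rate_cases[OF admissible_branch_min branch_extrema(2,4,6) \<theta> ratio, unfolded branch_extrema]
  note eqs = assouad_spectrum_eq_rate[OF \<theta>] lower_spectrum_eq_rate[OF \<theta>]
  show "assouad_spectrum \<theta> (sponge n D) = f1 n D \<theta> \<and> lower_spectrum \<theta> (sponge n D) = g1 n D \<theta>"
    if "\<theta> \<le> ln (n $ 1) / ln (n $ 3)"
    using mx(1) mn(1) that unfolding eqs f1_def g1_def by blast
  show "assouad_spectrum \<theta> (sponge n D) = f2 n D \<theta> \<and> lower_spectrum \<theta> (sponge n D) = g2 n D \<theta>"
    if "ln (n $ 1) / ln (n $ 3) < \<theta>" "\<theta> \<le> ln (n $ 1) / ln (n $ 2)"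
    using mx(2) mn(2) that unfolding eqs f2_def g2_def by blast
  show "assouad_spectrum \<theta> (sponge n D) = f3 n D \<theta> \<and> lower_spectrum \<theta> (sponge n D) = g3 n D \<theta>"
    if "ln (n $ 1) / ln (n $ 2) < \<theta>" "\<theta> \<le> ln (n $ 2) / ln (n $ 3)"
    using mx(3) mn(3) that unfolding eqs f3_def g3_def by blast
  show "assouad_spectrum \<theta> (sponge n D) = assouad_dim (sponge n D) \<and>
      lower_spectrum \<theta> (sponge n D) = lower_dim (sponge n D)"
    if "ln (n $ 2) / ln (n $ 3) < \<theta>"
    \<comment> \<open>Each dimension lies between the spectrum at \<open>\<theta>\<close> and
      \<open>assouad_rate\<close>, and in this range the two ends coincide.\<close>
    using mx(4) mn(4) that assouad_dim_bounds[OF \<theta>] lower_dim_bounds[OF \<theta>] unfolding eqs by simp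
qed

end

theorem theorem3p2:
  fixes n :: "nat ^ 3" and D :: "(nat ^ 3) set" and F :: "(real ^ 3) set"
  assumes "2 \<le> n $ 1" and "n $ 1 < n $ 2" and "n $ 2 < n $ 3"
    and "ln (n $ 1) / ln (n $ 2) < ln (n $ 2) / ln (n $ 3)"
    and "D \<subseteq> digit_box n" and "card D \<ge> 2"
    and "F = sponge n D"
    and "\<not> uniform_fibres n D"
  shows "(\<forall>\<theta>\<in>{0 <.. ln (n $ 1) / ln (n $ 3)}. assouad_spectrum \<theta> F = f1 n D \<theta>) \<and>
         (\<forall>\<theta>\<in>{ln (n $ 1) / ln (n $ 3) <.. ln (n $ 1) / ln (n $ 2)}.
            assouad_spectrum \<theta> F = f2 n D \<theta>) \<and>
         (\<forall>\<theta>\<in>{ln (n $ 1) / ln (n $ 2) <.. ln (n $ 2) / ln (n $ 3)}.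
            assouad_spectrum \<theta> F = f3 n D \<theta>) \<and>
         (\<forall>\<theta>\<in>{ln (n $ 2) / ln (n $ 3) <..< 1}. assouad_spectrum \<theta> F = assouad_dim F) \<and>
         (\<forall>\<theta>\<in>{0 <.. ln (n $ 1) / ln (n $ 3)}. lower_spectrum \<theta> F = g1 n D \<theta>) \<and>
         (\<forall>\<theta>\<in>{ln (n $ 1) / ln (n $ 3) <.. ln (n $ 1) / ln (n $ 2)}.
            lower_spectrum \<theta> F = g2 n D \<theta>) \<and>
         (\<forall>\<theta>\<in>{ln (n $ 1) / ln (n $ 2) <.. ln (n $ 2) / ln (n $ 3)}.
            lower_spectrum \<theta> F = g3 n D \<theta>) \<and>
         (\<forall>\<theta>\<in>{ln (n $ 2) / ln (n $ 3) <..< 1}. lower_spectrum \<theta> F = lower_dim F)"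
proof -
  have base: "2 \<le> n $ q" for q using assms(1-3) exhaust_3[of q] by auto
  have "D \<noteq> {}" using assms(6) by auto
  then interpret digit_sponge3 n D by unfold_locales (use base assms in auto)
  have l: "0 < ln (real (n $ 1))" "ln (real (n $ 1)) < ln (real (n $ 2))" "ln (real (n $ 2)) < ln (real (n $ 3))"
    using ln_base by auto
  then have "0 < ln (n $ 1) / ln (n $ 3)" "ln (n $ 1) / ln (n $ 3) < ln (n $ 1) / ln (n $ 2)" "ln (n $ 2) / ln (n $ 3) < 1"
    by (auto intro!: divide_strict_left_mono divide_pos_pos)
  \<comment> \<open>All break points lie strictly between 0 and 1, so every \<open>\<theta>\<close>
    of the eight ranges does too, as \<open>spectra\<close> requires.\<close>
  with assms(4) have range: "0 < ln (n $ 1) / ln (n $ 3)" "0 < ln (n $ 1) / ln (n $ 2)" "0 < ln (n $ 2) / ln (n $ 3)"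
    "ln (n $ 1) / ln (n $ 3) < 1" "ln (n $ 1) / ln (n $ 2) < 1" "ln (n $ 2) / ln (n $ 3) < 1"
    by linarith+
  note s = spectra[OF assms(4)]
  show ?thesis
    unfolding assms(7) using s range by (auto simp del: zero_less_divide_iff)
qed

end
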